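(* Let $(A,\mu,R,d)$ be a modified Rota-Baxter AssDer pair of weight $\kappa$ and let $(M,\mathbf{l},\mathbf{r},R_M,d_M)$ be a bimodule over it. Then $\big(\mathfrak{C}^\star_{\mathrm{mRBAD}^\kappa}(A;M),\mathfrak{D}^\star_{\mathrm{mRBAD}^\kappa}\big)$ is a cochain complex, i.e. $\mathfrak{D}^{n+1}_{\mathrm{mRBAD}^\kappa}\circ\mathfrak{D}^{n}_{\mathrm{mRBAD}^\kappa}=0$ for all $n\ge 1$.
   Context: All vector spaces and linear maps are over a field $\mathbb{K}$, and $\kappa\in\mathbb{K}$ is fixed. A modified Rota-Baxter associative algebra of weight $\kappa$ is an associative (not necessarily unital) algebra $(A,\mu)$ with a linear map $R:A\to A$ such that $\mu(R(a),R(b))=R\big(\mu(R(a),b)+\mu(a,R(b))\big)+\kappa\,\mu(a,b)$ for all $a,b\in A$. A modified Rota-Baxter AssDer pair $(A,\mu,R,d)$ of weight $\kappa$ is such an algebra together with a derivation $d:A\to A$ of $(A,\mu)$ with $R\circ d=d\circ R$. A bimodule $(M,\mathbf{l},\mathbf{r},R_M,d_M)$ over $(A,\mu,R,d)$ is a vector space $M$ with linear maps $\mathbf{l}:A\otimes M\to M$, $\mathbf{r}:M\otimes A\to M$, $R_M,d_M:M\to M$ such that for all $a,b\in A$, $m\in M$: (i) $\mathbf{l}(\mu(a,b),m)=\mathbf{l}(a,\mathbf{l}(b,m))$, $\mathbf{l}(a,\mathbf{r}(m,b))=\mathbf{r}(\mathbf{l}(a,m),b)$, $\mathbf{r}(m,\mu(a,b))=\mathbf{r}(\mathbf{r}(m,a),b)$;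 (ii) $\mathbf{l}(R(a),R_M(m))=R_M(\mathbf{l}(R(a),m)+\mathbf{l}(a,R_M(m)))+\kappa\,\mathbf{l}(a,m)$ and $\mathbf{r}(R_M(m),R(a))=R_M(\mathbf{r}(R_M(m),a)+\mathbf{r}(m,R(a)))+\kappa\,\mathbf{r}(m,a)$; (iii) $d_M(\mathbf{l}(a,m))=\mathbf{l}(d(a),m)+\mathbf{l}(a,d_M(m))$, $d_M(\mathbf{r}(m,a))=\mathbf{r}(d_M(m),a)+\mathbf{r}(m,d(a))$, $R_M\circ d_M=d_M\circ R_M$. For $n\ge1$ let $C^n(A;M)=\mathrm{Hom}(A^{\otimes n},M)$; $C^n(A_R;M)$ denotes the same vector space (used when $A$ carries the product $\mu_R(a,b)=\mu(R(a),b)+\mu(a,R(b))$). For $f\in \mathrm{Hom}(A^{\otimes n},M)$ define $$\delta^n_{\mathrm{Hoch}}(f)(a_1,\dots,a_{n+1})=(-1)^{n+1}\mathbf{l}(a_1,f(a_2,\dots,a_{n+1}))+\mathbf{r}(f(a_1,\dots,a_n),a_{n+1})+\sum_{i=1}^n(-1)^{i+n+1}f(a_1,\dots,\mu(a_i,a_{i+1}),\dots,a_{n+1}),$$ $$\begin{aligned}\delta^n_{\mathrm{mHoch}}(f)(a_1,\dots,a_{n+1})=&(-1)^{n+1}\mathbf{l}(R(a_1),f(a_2,\dots,a_{n+1}))-(-1)^{n+1}R_M(\mathbf{l}(a_1,f(a_2,\dots,a_{n+1})))\\&+\mathbf{r}(f(a_1,\dots,a_n),R(a_{n+1}))-R_M(\mathbf{r}(f(a_1,\dots,a_n),a_{n+1}))\\&+\sum_{i=1}^n(-1)^{i+n+1}f(a_1,\dots,\mu(R(a_i),a_{i+1})+\mu(a_i,R(a_{i+1})),\dots,a_{n+1}),\end{aligned}$$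 $$\begin{aligned}\phi^n(f)(a_1,\dots,a_n)=&f(R(a_1),\dots,R(a_n))-\sum_{\substack{1\le i_1<\dots<i_r\le n\\ r\ \mathrm{odd}}}(-\kappa)^{\frac{r-1}{2}}R_M\big(f(R(a_1),\dots,a_{i_1},\dots,a_{i_r},\dots,R(a_n))\big)\\&+\sum_{\substack{1\le i_1<\dots<i_r\le n\\ r\ge2\ \mathrm{even}}}(-\kappa)^{\frac r2}f(R(a_1),\dots,a_{i_1},\dots,a_{i_r},\dots,R(a_n)),\end{aligned}$$ where in each summand the argument in position $j$ is $a_j$ if $j\in\{i_1,\dots,i_r\}$ and $R(a_j)$ otherwise. Let $C^1_{\mathrm{mRBAA}^\kappa}(A;M)=\mathrm{Hom}(A,M)$ and $C^n_{\mathrm{mRBAA}^\kappa}(A;M)=C^n(A;M)\oplus C^{n-1}(A;M)$ for $n\ge2$, with $\partial^1_{\mathrm{mRBAA}^\kappa}(f)=(\delta^1_{\mathrm{Hoch}}f,-\phi^1f)$ and $\partial^n_{\mathrm{mRBAA}^\kappa}(f,g)=(\delta^n_{\mathrm{Hoch}}f,\,-\delta^{n-1}_{\mathrm{mHoch}}g-\phi^nf)$ for $n\ge2$. For $f\in C^n(A;M)$ put $\Delta^n(f)=\sum_{i=1}^n f\circ(\mathrm{Id}_A\otimes\cdots\otimes d\otimes\cdots\otimes\mathrm{Id}_A)-d_M\circ f$ ($d$ in the $i$-th place), and $\Delta^n(f,g)=(\Delta^nf,\Delta^{n-1}g)$ on $C^n_{\mathrm{mRBAA}^\kappa}(A;M)$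 for $n\ge2$. Let $\mathfrak{C}^1_{\mathrm{mRBAD}^\kappa}(A;M)=\mathrm{Hom}(A,M)$ and $\mathfrak{C}^n_{\mathrm{mRBAD}^\kappa}(A;M)=C^n_{\mathrm{mRBAA}^\kappa}(A;M)\times C^{n-1}_{\mathrm{mRBAA}^\kappa}(A;M)$ for $n\ge2$. Define $\mathfrak{D}^1_{\mathrm{mRBAD}^\kappa}(f)=(\partial^1_{\mathrm{mRBAA}^\kappa}f,-\Delta^1f)$ and, for $n\ge2$, $\mathfrak{D}^n_{\mathrm{mRBAD}^\kappa}(F,G)=\big(\partial^n_{\mathrm{mRBAA}^\kappa}F,\ \partial^{n-1}_{\mathrm{mRBAA}^\kappa}G+(-1)^n\Delta^nF\big)$ for $F\in C^n_{\mathrm{mRBAA}^\kappa}(A;M)$, $G\in C^{n-1}_{\mathrm{mRBAA}^\kappa}(A;M)$. *)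

theory Defs
  imports "HOL-Analysis.Product_Vector" "HOL-Library.Function_Algebras"
begin

text \<open>A vector space over the field \<open>'k\<close> is a type of class \<^class>\<open>ab_group_add\<close> with a scalar
  multiplication satisfying \<^const>\<open>vector_space\<close>; a linear map out of a tensor product is given by
  the corresponding multilinear map.\<close>

definition bilinear_map ::
  "('k::field \<Rightarrow> 'a::ab_group_add \<Rightarrow> 'a) \<Rightarrow> ('k \<Rightarrow> 'b::ab_group_add \<Rightarrow> 'b) \<Rightarrow>
   ('k \<Rightarrow> 'c::ab_group_add \<Rightarrow> 'c) \<Rightarrow> ('a \<Rightarrow> 'b \<Rightarrow> 'c) \<Rightarrow> bool" where
  "bilinear_map s1 s2 s3 h \<longleftrightarrow>
     (\<forall>y. Vector_Spaces.linear s1 s3 (\<lambda>x. h x y)) \<and> (\<forall>x. Vector_Spaces.linear s2 s3 (h x))"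

locale modified_RB_algebra = A: vector_space sA
  for sA :: "'k::field \<Rightarrow> 'a::ab_group_add \<Rightarrow> 'a" +
  fixes \<kappa> :: 'k and \<mu> :: "'a \<Rightarrow> 'a \<Rightarrow> 'a" and R :: "'a \<Rightarrow> 'a"
  assumes mu_bilinear: "bilinear_map sA sA sA \<mu>"
    and mu_assoc: "\<mu> (\<mu> a b) c = \<mu> a (\<mu> b c)"
    and R_linear: "Vector_Spaces.linear sA sA R"
    and R_modified: "\<mu> (R a) (R b) = R (\<mu> (R a) b + \<mu> a (R b)) + sA \<kappa> (\<mu> a b)"

locale modified_RB_AssDer_pair = modified_RB_algebra sA \<kappa> \<mu> R
  for sA :: "'k::field \<Rightarrow> 'a::ab_group_add \<Rightarrow> 'a" and \<kappa> \<mu> R +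
  fixes d :: "'a \<Rightarrow> 'a"
  assumes d_linear: "Vector_Spaces.linear sA sA d"
    and d_derivation: "d (\<mu> a b) = \<mu> (d a) b + \<mu> a (d b)"
    and R_d_commute: "R \<circ> d = d \<circ> R"

locale modified_RB_AssDer_bimodule =
  modified_RB_AssDer_pair sA \<kappa> \<mu> R d + M: vector_space sM
  for sA :: "'k::field \<Rightarrow> 'a::ab_group_add \<Rightarrow> 'a" and \<kappa> \<mu> R d
    and sM :: "'k \<Rightarrow> 'm::ab_group_add \<Rightarrow> 'm" +
  fixes l :: "'a \<Rightarrow> 'm \<Rightarrow> 'm" and r :: "'m \<Rightarrow> 'a \<Rightarrow> 'm"
    and RM :: "'m \<Rightarrow> 'm" and dM :: "'m \<Rightarrow> 'm"
  assumes l_bilinear: "bilinear_map sA sM sM l"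
    and r_bilinear: "bilinear_map sM sA sM r"
    and RM_linear: "Vector_Spaces.linear sM sM RM"
    and dM_linear: "Vector_Spaces.linear sM sM dM"
    and l_mu: "l (\<mu> a b) m = l a (l b m)"
    and l_r: "l a (r m b) = r (l a m) b"
    and r_mu: "r m (\<mu> a b) = r (r m a) b"
    and l_modified: "l (R a) (RM m) = RM (l (R a) m + l a (RM m)) + sM \<kappa> (l a m)"
    and r_modified: "r (RM m) (R a) = RM (r (RM m) a + r m (R a)) + sM \<kappa> (r m a)"
    and dM_l: "dM (l a m) = l (d a) m + l a (dM m)"
    and dM_r: "dM (r m a) = r (dM m) a + r m (d a)"
    and RM_dM_commute: "RM \<circ> dM = dM \<circ> RM"


text \<open>An \<open>n\<close>-cochain is a function on argument lists \<open>[a\<^sub>1, \<dots>, a\<^sub>n]\<close>. It is required to vanish on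
  lists of any other length, so that cochains of degree \<open>n\<close> correspond bijectively to multilinear
  maps in \<open>n\<close> arguments; the operators below accordingly return 0 on lists of the wrong length.
  Addition, negation and zero of cochains are the pointwise ones.\<close>

type_synonym ('a, 'm) cochain = "'a list \<Rightarrow> 'm"

definition cochains ::
  "('k::field \<Rightarrow> 'a::ab_group_add \<Rightarrow> 'a) \<Rightarrow> ('k \<Rightarrow> 'm::ab_group_add \<Rightarrow> 'm) \<Rightarrow> nat \<Rightarrow>
   ('a, 'm) cochain set" where
  "cochains sA sM n =
     {f. (\<forall>xs. length xs \<noteq> n \<longrightarrow> f xs = 0) \<and>
         (\<forall>xs i. length xs = n \<longrightarrow> i < n \<longrightarrow>
            Vector_Spaces.linear sA sM (\<lambda>x. f (xs[i := x])))}"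

definition scale_cochain :: "('k \<Rightarrow> 'm \<Rightarrow> 'm) \<Rightarrow> 'k \<Rightarrow> ('a, 'm) cochain \<Rightarrow> ('a, 'm) cochain" where
  "scale_cochain sM c f = (\<lambda>xs. sM c (f xs))"

text \<open>\<open>merge p i [a\<^sub>1, \<dots>, a\<^sub>n\<^sub>+\<^sub>1] = [a\<^sub>1, \<dots>, p a\<^sub>i a\<^sub>i\<^sub>+\<^sub>1, \<dots>, a\<^sub>n\<^sub>+\<^sub>1]\<close> for \<open>1 \<le> i \<le> n\<close>;
  note that \<open>a\<^sub>i = xs ! (i - 1)\<close>.\<close>

definition merge :: "('a \<Rightarrow> 'a \<Rightarrow> 'a) \<Rightarrow> nat \<Rightarrow> 'a list \<Rightarrow> 'a list" where
  "merge p i xs = take (i - 1) xs @ [p (xs ! (i - 1)) (xs ! i)] @ drop (i + 1) xs"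

definition delta_Hoch ::
  "('k::field \<Rightarrow> 'm::ab_group_add \<Rightarrow> 'm) \<Rightarrow> ('a \<Rightarrow> 'a \<Rightarrow> 'a) \<Rightarrow> ('a \<Rightarrow> 'm \<Rightarrow> 'm) \<Rightarrow> ('m \<Rightarrow> 'a \<Rightarrow> 'm) \<Rightarrow>
   nat \<Rightarrow> ('a, 'm) cochain \<Rightarrow> ('a, 'm) cochain" where
  "delta_Hoch sM \<mu> l r n f = (\<lambda>xs.
     if length xs = n + 1 then
       sM ((-1) ^ (n + 1)) (l (hd xs) (f (tl xs)))
       + r (f (butlast xs)) (last xs)
       + (\<Sum>i = 1..n. sM ((-1) ^ (i + n + 1)) (f (merge \<mu> i xs)))
     else 0)"

definition delta_mHoch ::
  "('k::field \<Rightarrow> 'm::ab_group_add \<Rightarrow> 'm) \<Rightarrow> ('a::ab_group_add \<Rightarrow> 'a \<Rightarrow> 'a) \<Rightarrow> ('a \<Rightarrow> 'a) \<Rightarrow>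
   ('a \<Rightarrow> 'm \<Rightarrow> 'm) \<Rightarrow> ('m \<Rightarrow> 'a \<Rightarrow> 'm) \<Rightarrow> ('m \<Rightarrow> 'm) \<Rightarrow>
   nat \<Rightarrow> ('a, 'm) cochain \<Rightarrow> ('a, 'm) cochain" where
  "delta_mHoch sM \<mu> R l r RM n f = (\<lambda>xs.
     if length xs = n + 1 then
       sM ((-1) ^ (n + 1)) (l (R (hd xs)) (f (tl xs)))
       - sM ((-1) ^ (n + 1)) (RM (l (hd xs) (f (tl xs))))
       + r (f (butlast xs)) (R (last xs))
       - RM (r (f (butlast xs)) (last xs))
       + (\<Sum>i = 1..n. sM ((-1) ^ (i + n + 1)) (f (merge (\<lambda>a b. \<mu> (R a) b + \<mu> a (R b)) i xs)))
     else 0)"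

text \<open>\<open>apply_off R I xs\<close> applies \<open>R\<close> to the entries of \<open>xs\<close> at the (0-based) positions outside \<open>I\<close>.\<close>

definition apply_off :: "('a \<Rightarrow> 'a) \<Rightarrow> nat set \<Rightarrow> 'a list \<Rightarrow> 'a list" where
  "apply_off R I xs = map (\<lambda>j. if j \<in> I then xs ! j else R (xs ! j)) [0..<length xs]"

definition phi ::
  "('k::field \<Rightarrow> 'm::ab_group_add \<Rightarrow> 'm) \<Rightarrow> 'k \<Rightarrow> ('a \<Rightarrow> 'a) \<Rightarrow> ('m \<Rightarrow> 'm) \<Rightarrow>
   nat \<Rightarrow> ('a, 'm) cochain \<Rightarrow> ('a, 'm) cochain" where
  "phi sM \<kappa> R RM n f = (\<lambda>xs.
     if length xs = n then
       f (map R xs)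
       - (\<Sum>I | I \<subseteq> {..<n} \<and> odd (card I).
            sM ((- \<kappa>) ^ ((card I - 1) div 2)) (RM (f (apply_off R I xs))))
       + (\<Sum>I | I \<subseteq> {..<n} \<and> even (card I) \<and> card I \<ge> 2.
            sM ((- \<kappa>) ^ (card I div 2)) (f (apply_off R I xs)))
     else 0)"

definition Delta ::
  "('a \<Rightarrow> 'a) \<Rightarrow> ('m::ab_group_add \<Rightarrow> 'm) \<Rightarrow> nat \<Rightarrow> ('a, 'm) cochain \<Rightarrow> ('a, 'm) cochain" where
  "Delta d dM n f = (\<lambda>xs.
     if length xs = n then (\<Sum>i<n. f (xs[i := d (xs ! i)])) - dM (f xs) else 0)"


text \<open>To give all degrees the same type, \<open>Hom(A, M)\<close> in degree 1 is represented as
  \<open>Hom(A, M) \<oplus> 0\<close>, here and again in \<open>mRBAD_cochains\<close>; the degree 1 clauses of the operators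
  ignore the zero component.\<close>

definition mRBAA_cochains ::
  "('k::field \<Rightarrow> 'a::ab_group_add \<Rightarrow> 'a) \<Rightarrow> ('k \<Rightarrow> 'm::ab_group_add \<Rightarrow> 'm) \<Rightarrow> nat \<Rightarrow>
   (('a, 'm) cochain \<times> ('a, 'm) cochain) set" where
  "mRBAA_cochains sA sM n =
     (if n = 1 then cochains sA sM 1 \<times> {0} else cochains sA sM n \<times> cochains sA sM (n - 1))"

definition mRBAA_diff ::
  "('k::field \<Rightarrow> 'm::ab_group_add \<Rightarrow> 'm) \<Rightarrow> 'k \<Rightarrow> ('a::ab_group_add \<Rightarrow> 'a \<Rightarrow> 'a) \<Rightarrow> ('a \<Rightarrow> 'a) \<Rightarrow>
   ('a \<Rightarrow> 'm \<Rightarrow> 'm) \<Rightarrow> ('m \<Rightarrow> 'a \<Rightarrow> 'm) \<Rightarrow> ('m \<Rightarrow> 'm) \<Rightarrow> nat \<Rightarrow>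
   ('a, 'm) cochain \<times> ('a, 'm) cochain \<Rightarrow> ('a, 'm) cochain \<times> ('a, 'm) cochain" where
  "mRBAA_diff sM \<kappa> \<mu> R l r RM n = (\<lambda>(f, g).
     if n = 1 then (delta_Hoch sM \<mu> l r 1 f, - phi sM \<kappa> R RM 1 f)
     else (delta_Hoch sM \<mu> l r n f,
           - delta_mHoch sM \<mu> R l r RM (n - 1) g - phi sM \<kappa> R RM n f))"

definition mRBAA_Delta ::
  "('a \<Rightarrow> 'a) \<Rightarrow> ('m::ab_group_add \<Rightarrow> 'm) \<Rightarrow> nat \<Rightarrow>
   ('a, 'm) cochain \<times> ('a, 'm) cochain \<Rightarrow> ('a, 'm) cochain \<times> ('a, 'm) cochain" where
  "mRBAA_Delta d dM n = (\<lambda>(f, g).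
     if n = 1 then (Delta d dM 1 f, 0) else (Delta d dM n f, Delta d dM (n - 1) g))"

definition scale_mRBAA ::
  "('k::field \<Rightarrow> 'm::ab_group_add \<Rightarrow> 'm) \<Rightarrow> 'k \<Rightarrow>
   ('a, 'm) cochain \<times> ('a, 'm) cochain \<Rightarrow> ('a, 'm) cochain \<times> ('a, 'm) cochain" where
  "scale_mRBAA sM = module_prod.scale (scale_cochain sM) (scale_cochain sM)"

type_synonym ('a, 'm) mRBAD_cochain =
  "(('a, 'm) cochain \<times> ('a, 'm) cochain) \<times> (('a, 'm) cochain \<times> ('a, 'm) cochain)"

definition mRBAD_cochains ::
  "('k::field \<Rightarrow> 'a::ab_group_add \<Rightarrow> 'a) \<Rightarrow> ('k \<Rightarrow> 'm::ab_group_add \<Rightarrow> 'm) \<Rightarrow> nat \<Rightarrow>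
   ('a, 'm) mRBAD_cochain set" where
  "mRBAD_cochains sA sM n =
     (if n = 1 then mRBAA_cochains sA sM 1 \<times> {0}
      else mRBAA_cochains sA sM n \<times> mRBAA_cochains sA sM (n - 1))"

definition scale_mRBAD ::
  "('k::field \<Rightarrow> 'm::ab_group_add \<Rightarrow> 'm) \<Rightarrow> 'k \<Rightarrow>
   ('a, 'm) mRBAD_cochain \<Rightarrow> ('a, 'm) mRBAD_cochain" where
  "scale_mRBAD sM = module_prod.scale (scale_mRBAA sM) (scale_mRBAA sM)"

definition mRBAD_diff ::
  "('k::field \<Rightarrow> 'm::ab_group_add \<Rightarrow> 'm) \<Rightarrow> 'k \<Rightarrow> ('a::ab_group_add \<Rightarrow> 'a \<Rightarrow> 'a) \<Rightarrow> ('a \<Rightarrow> 'a) \<Rightarrow>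
   ('a \<Rightarrow> 'a) \<Rightarrow> ('a \<Rightarrow> 'm \<Rightarrow> 'm) \<Rightarrow> ('m \<Rightarrow> 'a \<Rightarrow> 'm) \<Rightarrow> ('m \<Rightarrow> 'm) \<Rightarrow> ('m \<Rightarrow> 'm) \<Rightarrow> nat \<Rightarrow>
   ('a, 'm) mRBAD_cochain \<Rightarrow> ('a, 'm) mRBAD_cochain" where
  "mRBAD_diff sM \<kappa> \<mu> R d l r RM dM n = (\<lambda>(F, G).
     if n = 1 then (mRBAA_diff sM \<kappa> \<mu> R l r RM 1 F, - mRBAA_Delta d dM 1 F)
     else (mRBAA_diff sM \<kappa> \<mu> R l r RM n F,
           mRBAA_diff sM \<kappa> \<mu> R l r RM (n - 1) G
             + scale_mRBAA sM ((-1) ^ n) (mRBAA_Delta d dM n F)))"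


text \<open>Cochain complexes of vector spaces in degrees \<open>n \<ge> 1\<close>, realised as subspaces of one
  ambient vector space.\<close>

definition cochain_complex ::
  "('k::field \<Rightarrow> 'v::ab_group_add \<Rightarrow> 'v) \<Rightarrow> (nat \<Rightarrow> 'v set) \<Rightarrow> (nat \<Rightarrow> 'v \<Rightarrow> 'v) \<Rightarrow> bool" where
  "cochain_complex s C D \<longleftrightarrow>
     vector_space s \<and>
     (\<forall>n\<ge>1. module.subspace s (C n)) \<and>
     (\<forall>n\<ge>1. \<forall>x\<in>C n. D n x \<in> C (n + 1)) \<and>
     (\<forall>n\<ge>1. \<forall>x\<in>C n. \<forall>y\<in>C n. D n (x + y) = D n x + D n y) \<and>
     (\<forall>n\<ge>1. \<forall>c. \<forall>x\<in>C n. D n (s c x) = s c (D n x)) \<and>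
     (\<forall>n\<ge>1. \<forall>x\<in>C n. D (n + 1) (D n x) = 0)"

end

theory Submission
  imports Defs
begin

text \<open>The product \<open>\<mu>\<^sub>R a b = \<mu> (R a) b + \<mu> a (R b)\<close> is associative, \<open>M\<close> is a bimodule over it through
  \<open>l\<^sub>R a m = l (R a) m - RM (l a m)\<close> and \<open>r\<^sub>R m a = r m (R a) - RM (r m a)\<close>, and \<open>delta_mHoch\<close> is the
  Hochschild differential of these data. Adjoin a square root \<open>t\<close> of \<open>- \<kappa>\<close>: the modified Rota-Baxter
  identity says that \<open>R + t\<close> is a homomorphism from \<open>(A, \<mu>\<^sub>R)\<close> to \<open>A[t]\<close>, and \<open>m\<^sub>0 + t m\<^sub>1 \<mapsto> m\<^sub>0 - RM m\<^sub>1\<close>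
  is a homomorphism of \<open>(A, \<mu>\<^sub>R)\<close>-bimodules from \<open>M[t]\<close> to \<open>M\<close>. The map \<open>phi\<close> is the pullback along the
  former followed by the latter, hence a cochain map. The operator \<open>Delta\<close> commutes with both
  Hochschild differentials because \<open>(d, dM)\<close> is a derivation for either structure, and with \<open>phi\<close>
  because \<open>(d, dM)\<close> commutes with \<open>(R, RM)\<close>.\<close>

section \<open>Multilinear functions on argument lists\<close>

lemma linear_compose_apply:
  "Vector_Spaces.linear s1 s2 f \<Longrightarrow> Vector_Spaces.linear s2 s3 g \<Longrightarrow>
    Vector_Spaces.linear s1 s3 (\<lambda>x. g (f x))"
  by (auto simp: Vector_Spaces.linear_iff)

text \<open>No length is fixed: such a function is one multilinear map in each degree. Freezing the
  first argument stays inside the notion, so proofs can run by induction on the list without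
  counting degrees.\<close>

definition multilinear ::
  "('k::field \<Rightarrow> 'a::ab_group_add \<Rightarrow> 'a) \<Rightarrow> ('k \<Rightarrow> 'm::ab_group_add \<Rightarrow> 'm) \<Rightarrow> ('a, 'm) cochain \<Rightarrow> bool"
  where "multilinear sA sM f \<longleftrightarrow> (\<forall>us vs. Vector_Spaces.linear sA sM (\<lambda>x. f (us @ x # vs)))"

lemma multilinear_Cons:
  "multilinear sA sM f \<longleftrightarrow>
    (\<forall>vs. Vector_Spaces.linear sA sM (\<lambda>x. f (x # vs))) \<and>
    (\<forall>a. multilinear sA sM (\<lambda>ys. f (a # ys)))" (is "?L \<longleftrightarrow> ?R")
proof
  assume ?L
  then have "Vector_Spaces.linear sA sM (\<lambda>x. f (us @ x # vs))" for us vs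
    by (simp add: multilinear_def)
  from this[of "[]"] this[of "_ # _"] show ?R
    by (auto simp: multilinear_def)
next
  assume ?R
  then have "Vector_Spaces.linear sA sM (\<lambda>x. f (us @ x # vs))" for us vs
    by (cases us) (auto simp: multilinear_def)
  then show ?L by (auto simp: multilinear_def)
qed

lemma multilinear_head:
  "multilinear sA sM f \<Longrightarrow> Vector_Spaces.linear sA sM (\<lambda>x. f (x # vs))"
  by (simp add: multilinear_Cons[of _ _ f])

lemma multilinear_tail:
  "multilinear sA sM f \<Longrightarrow> multilinear sA sM (\<lambda>ys. f (a # ys))"
  by (simp add: multilinear_Cons[of _ _ f])

lemma multilinear_compose:
  "multilinear sA sM f \<Longrightarrow> Vector_Spaces.linear sM sN g \<Longrightarrow> multilinear sA sN (\<lambda>xs. g (f xs))"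
  by (auto simp: multilinear_def intro: linear_compose_apply[of sA sM _ sN g])

lemma multilinear_head_add:
  "multilinear sA sM f \<Longrightarrow> f ((x + y) # vs) = f (x # vs) + f (y # vs)"
  by (drule multilinear_head[of _ _ _ vs]) (simp add: Vector_Spaces.linear_iff)

lemma multilinear_head_scale:
  "multilinear sA sM f \<Longrightarrow> f (sA c x # vs) = sM c (f (x # vs))"
  by (drule multilinear_head[of _ _ _ vs]) (simp add: Vector_Spaces.linear_iff)

context vector_space_pair
begin

lemma multilinear_add:
  "multilinear s1 s2 f \<Longrightarrow> multilinear s1 s2 g \<Longrightarrow> multilinear s1 s2 (\<lambda>xs. f xs + g xs)"
  by (simp add: multilinear_def linear_compose_add)

lemma multilinear_diff:
  "multilinear s1 s2 f \<Longrightarrow> multilinear s1 s2 g \<Longrightarrow> multilinear s1 s2 (\<lambda>xs. f xs - g xs)"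
  by (simp add: multilinear_def linear_compose_sub)

lemma multilinear_scale:
  "multilinear s1 s2 f \<Longrightarrow> multilinear s1 s2 (\<lambda>xs. s2 c (f xs))"
  by (simp add: multilinear_def linear_compose_scale_right)

text \<open>On lists of the wrong length a cochain is zero, hence linear in each entry, so its
  linearity extends to lists of every length.\<close>

lemma cochains_iff:
  "f \<in> cochains s1 s2 n \<longleftrightarrow> multilinear s1 s2 f \<and> (\<forall>xs. length xs \<noteq> n \<longrightarrow> f xs = 0)"
    (is "?L \<longleftrightarrow> ?R")
proof
  assume L: ?L
  then have z: "f xs = 0" if "length xs \<noteq> n" for xs
    using that by (simp add: cochains_def)
  have "Vector_Spaces.linear s1 s2 (\<lambda>x. f (us @ x # vs))" for us vs
  proof (cases "length us + Suc (length vs) = n")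
    case True
    \<comment> \<open>The entry 0 is a placeholder that the update overwrites.\<close>
    then have "Vector_Spaces.linear s1 s2 (\<lambda>x. f ((us @ 0 # vs)[length us := x]))"
      using L[unfolded cochains_def mem_Collect_eq, THEN conjunct2, rule_format,
          of "us @ 0 # vs" "length us"] by simp
    then show ?thesis by simp
  next
    case False
    then show ?thesis by (simp add: z linear_zero)
  qed
  with z show ?R by (simp add: multilinear_def)
next
  assume ?R
  then show ?L
    by (auto simp: cochains_def multilinear_def upd_conv_take_nth_drop)
qed

lemma cochains_scale: "f \<in> cochains s1 s2 n \<Longrightarrow> scale_cochain s2 c f \<in> cochains s1 s2 n"
  by (auto simp: cochains_iff scale_cochain_def intro: multilinear_scale)

lemma cochains_add: "f \<in> cochains s1 s2 n \<Longrightarrow> g \<in> cochains s1 s2 n \<Longrightarrow> f + g \<in> cochains s1 s2 n"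
  by (auto simp: cochains_iff plus_fun_def intro: multilinear_add)

lemma cochains_diff: "f \<in> cochains s1 s2 n \<Longrightarrow> g \<in> cochains s1 s2 n \<Longrightarrow> f - g \<in> cochains s1 s2 n"
  by (auto simp: cochains_iff fun_diff_def intro: multilinear_diff)

lemma cochains_0: "0 \<in> cochains s1 s2 n"
  by (simp add: cochains_iff multilinear_def linear_zero)

lemma cochains_minus: "f \<in> cochains s1 s2 n \<Longrightarrow> - f \<in> cochains s1 s2 n"
  using cochains_diff[OF cochains_0] by fastforce

end

lemma vector_space_scale_cochain:
  assumes "vector_space s" shows "vector_space (scale_cochain s)"
proof -
  interpret vector_space s by fact
  show ?thesis
    by unfold_locales (auto simp: scale_cochain_def fun_eq_iff algebra_simps)
qed

section \<open>The Hochschild differential\<close>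

text \<open>The inner faces of the Hochschild differential, the merge at position i carrying the
  sign (-1)^i. Passing to the tail lowers every position by one, which explains the minus sign
  before the recursive call.\<close>

fun bar :: "('a \<Rightarrow> 'a \<Rightarrow> 'a) \<Rightarrow> ('a, 'm::ab_group_add) cochain \<Rightarrow> ('a, 'm) cochain" where
  "bar p f [] = 0"
| "bar p f [a] = 0"
| "bar p f (a # b # xs) = - f (p a b # xs) - bar p (\<lambda>ys. f (a # ys)) (b # xs)"

lemma merge_Cons: "i \<ge> 1 \<Longrightarrow> merge p (Suc i) (a # xs) = a # merge p i xs"
  by (cases i) (auto simp: merge_def)

lemma bar_eq_sum:
  fixes sM :: "'k::field \<Rightarrow> 'c::ab_group_add \<Rightarrow> 'c"
  assumes "vector_space sM" "length xs = Suc n"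
  shows "bar p f xs = (\<Sum>i = 1..n. sM ((-1) ^ i) (f (merge p i xs)))"
proof -
  interpret M: vector_space sM by fact
  show ?thesis
    using assms(2)
  proof (induction xs arbitrary: f n rule: induct_list012)
    case (3 a b xs)
    from "3.prems" have n: "n = Suc (length xs)" "length (b # xs) = Suc (length xs)" by simp_all
    have sum_shift: "(\<Sum>i = 1..Suc m. g i) = g 1 + (\<Sum>i = 1..m. g (Suc i))" for g :: "nat \<Rightarrow> 'c" and m
      by (induction m) (simp_all add: add.assoc)
    have m1: "merge p 1 (a # b # xs) = p a b # xs" by (simp add: merge_def)
    have "(\<Sum>i = 1..length xs. sM ((-1) ^ Suc i) (f (merge p (Suc i) (a # b # xs)))) =
        - (\<Sum>i = 1..length xs. sM ((-1) ^ i) (f (a # merge p i (b # xs))))"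
      unfolding sum_negf[symmetric] by (rule sum.cong) (simp_all add: merge_Cons)
    moreover have "bar p (\<lambda>ys. f (a # ys)) (b # xs) =
        (\<Sum>i = 1..length xs. sM ((-1) ^ i) (f (a # merge p i (b # xs))))"
      using "3.IH"(2) n(2) .
    ultimately show ?case
      unfolding n(1) sum_shift m1 bar.simps by simp
  qed auto
qed

text \<open>On a fixed list \<open>bar\<close> sees only arguments shorter by one. A function may
  thus be replaced by an expression in \<open>hd\<close> and \<open>tl\<close> that agrees with it
  on nonempty lists.\<close>

lemma bar_cong:
  "(\<And>ys. Suc (length ys) = length xs \<Longrightarrow> f ys = g ys) \<Longrightarrow> bar p f xs = bar p g xs"
proof (induction xs arbitrary: f g rule: induct_list012)
  case (3 a b xs)
  have "bar p (\<lambda>ys. f (a # ys)) (b # xs) = bar p (\<lambda>ys. g (a # ys)) (b # xs)"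
    by (rule "3.IH"(2)) (rule "3.prems", simp)
  moreover have "f (p a b # xs) = g (p a b # xs)"
    by (rule "3.prems") simp
  ultimately show ?case by simp
qed simp_all

lemma bar_zero: "bar p (\<lambda>xs. 0) xs = 0"
  by (induction xs rule: induct_list012) auto

lemma bar_eq_0:
  "(\<And>ys. Suc (length ys) = length xs \<Longrightarrow> f ys = 0) \<Longrightarrow> bar p f xs = 0"
  using bar_cong[of xs f "\<lambda>xs. 0" p] by (simp add: bar_zero)

lemma bar_add: "bar p (\<lambda>xs. f xs + g xs) xs = bar p f xs + bar p g xs"
  by (induction xs arbitrary: f g rule: induct_list012) auto

lemma bar_additive:
  assumes "additive T"
  shows "bar p (\<lambda>xs. T (f xs)) xs = T (bar p f xs)"
proof -
  interpret additive T by fact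
  show ?thesis
    by (induction xs arbitrary: f rule: induct_list012) (auto simp: zero minus diff)
qed

lemma bar_minus: "bar p (\<lambda>xs. - f xs) xs = - bar p f xs"
  by (rule bar_additive) (simp add: additive_def)

lemma bar_diff: "bar p (\<lambda>xs. f xs - g xs) xs = bar p f xs - bar p g xs"
  using bar_add[of p f "\<lambda>xs. - g xs"] by (simp add: bar_minus)

text \<open>Expand at the head: the two ways of merging the first three entries cancel by
  associativity, the terms combining the first merge with a later one cancel in pairs, and the
  induction hypothesis disposes of the rest.\<close>

lemma bar_bar:
  assumes assoc: "\<And>a b c. p (p a b) c = p a (p b c)"
  shows "bar p (bar p f) xs = 0"
proof (induction xs arbitrary: f rule: induct_list012)
  case (3 a b xs)
  show ?case
  proof (cases xs)
    case (Cons c ys)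
    \<comment> \<open>The inner lists have length at least one, so the recursion for
      \<open>bar p f (a # zs)\<close> unfolds.\<close>
    have "bar p (\<lambda>zs. bar p f (a # zs)) (b # c # ys) =
        bar p (\<lambda>zs. - f (p a (hd zs) # tl zs) - bar p (\<lambda>ys. f (a # ys)) zs) (b # c # ys)"
      by (rule bar_cong) (auto simp: length_Suc_conv)
    also have "\<dots> = f (p a (p b c) # ys) + bar p (\<lambda>ys. f (p a b # ys)) (c # ys)"
      using "3.IH"(2)[of "\<lambda>ys. f (a # ys)"] Cons by (simp add: bar_diff bar_minus)
    finally show ?thesis
      using Cons by (simp add: assoc)
  qed simp
qed auto

locale assoc_bimodule = vector_space_pair sA sM
  for sA :: "'k::field \<Rightarrow> 'a::ab_group_add \<Rightarrow> 'a" and sM :: "'k \<Rightarrow> 'm::ab_group_add \<Rightarrow> 'm" +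
  fixes p :: "'a \<Rightarrow> 'a \<Rightarrow> 'a" and l :: "'a \<Rightarrow> 'm \<Rightarrow> 'm" and r :: "'m \<Rightarrow> 'a \<Rightarrow> 'm"
  assumes p_bilinear: "bilinear_map sA sA sA p"
    and l_bilinear: "bilinear_map sA sM sM l"
    and r_bilinear: "bilinear_map sM sA sM r"
    and p_assoc: "p (p a b) c = p a (p b c)"
    and l_p: "l (p a b) m = l a (l b m)"
    and l_r: "l a (r m b) = r (l a m) b"
    and r_p: "r m (p a b) = r (r m a) b"
begin

lemma p_linear: "Vector_Spaces.linear sA sA (\<lambda>x. p x b)" "Vector_Spaces.linear sA sA (p a)"
  and l_linear: "Vector_Spaces.linear sA sM (\<lambda>x. l x m)" "Vector_Spaces.linear sM sM (l a)"
  and r_linear: "Vector_Spaces.linear sM sM (\<lambda>x. r x a)" "Vector_Spaces.linear sA sM (r m)"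
  using p_bilinear l_bilinear r_bilinear by (auto simp: bilinear_map_def)

lemmas l_simps = module_hom.zero[OF module_hom_linearI, OF l_linear(2)]
    module_hom.add[OF module_hom_linearI, OF l_linear(2)]
    module_hom.neg[OF module_hom_linearI, OF l_linear(2)]
    module_hom.diff[OF module_hom_linearI, OF l_linear(2)]
    module_hom.scale[OF module_hom_linearI, OF l_linear(2)]

lemmas r_simps = module_hom.zero[OF module_hom_linearI, OF r_linear(1)]
    module_hom.add[OF module_hom_linearI, OF r_linear(1)]
    module_hom.neg[OF module_hom_linearI, OF r_linear(1)]
    module_hom.diff[OF module_hom_linearI, OF r_linear(1)]
    module_hom.scale[OF module_hom_linearI, OF r_linear(1)]

text \<open>This outer face and \<open>right\<close> use the unspecified \<open>hd []\<close> and
  \<open>last []\<close> on the empty list. If \<open>f [] = 0\<close> the value is still zero,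
  because the actions are linear in \<open>M\<close>.\<close>

definition left :: "('a, 'm) cochain \<Rightarrow> ('a, 'm) cochain" where
  "left f xs = l (hd xs) (f (tl xs))"

definition right :: "('a, 'm) cochain \<Rightarrow> ('a, 'm) cochain" where
  "right f xs = r (f (butlast xs)) (last xs)"

text \<open>Up to a global sign this is \<open>delta_Hoch\<close> in degree \<open>n\<close> when \<open>s = (-1)\<^sup>n\<^sup>+\<^sup>1\<close>. Compatibility with
  derivations and with \<open>phi\<close> holds for every \<open>s\<close>, so no degrees have to be tracked there.\<close>

definition hoch :: "'k \<Rightarrow> ('a, 'm) cochain \<Rightarrow> ('a, 'm) cochain" where
  "hoch s f xs = left f xs + bar p f xs + sM s (right f xs)"

text \<open>Merging the first two entries gives \<open>l (p a b)\<close>, which cancels the iterated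
  left action by \<open>l_p\<close>; all other merges commute with \<open>l a\<close>.\<close>

lemma left_left: "left (left f) (a # b # xs) + left (bar p f) (a # b # xs) + bar p (left f) (a # b # xs) = 0"
proof -
  have "bar p (\<lambda>ys. left f (a # ys)) (b # xs) = l a (bar p f (b # xs))"
    by (simp add: left_def bar_additive[of "l a"] additive_def l_simps)
  then show ?thesis by (simp add: left_def l_p)
qed

lemma left_right: "left (right f) (a # b # xs) = right (left f) (a # b # xs)"
  by (simp add: left_def right_def l_r)

text \<open>Merges away from the last entry commute with the right action. The merge of the last two
  entries is the iterated right action by \<open>r_p\<close>, and its sign records its position,
  \<open>length xs - 1\<close>.\<close>

lemma bar_right:
  "length xs \<ge> 2 \<Longrightarrow>
    bar p (right f) xs = right (bar p f) xs + sM ((-1) ^ (length xs - 1)) (right (right f) xs)"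
proof (induction xs arbitrary: f rule: induct_list012)
  case (3 a b xs)
  show ?case
  proof (cases "xs = []")
    case False
    \<comment> \<open>\<open>butlast\<close> keeps the head \<open>a\<close> because the remaining
      list is nonempty.\<close>
    have "bar p (\<lambda>ys. right f (a # ys)) (b # xs) = bar p (right (\<lambda>ys. f (a # ys))) (b # xs)"
      by (rule bar_cong) (use False in \<open>auto simp: right_def\<close>)
    also have "\<dots> = right (bar p (\<lambda>ys. f (a # ys))) (b # xs)
        + sM ((-1) ^ length xs) (right (right (\<lambda>ys. f (a # ys))) (b # xs))"
      using "3.IH"(2)[of "\<lambda>ys. f (a # ys)"] False by (cases xs) auto
    finally show ?thesis
      using False by (cases xs) (auto simp: right_def r_simps)
  qed (simp add: right_def r_p r_simps)
qed auto

text \<open>The sign of the right face flips from one degree to the next, so the two mixed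
  left-right terms cancel. \<open>left_left\<close> removes the terms without a right face, and
  \<open>bar_right\<close> matches the remaining ones.\<close>

lemma hoch_hoch:
  assumes f: "\<And>xs. length xs \<noteq> n \<Longrightarrow> f xs = 0" and n: "n \<ge> 1" and s: "s = (-1) ^ (n + 1)"
  shows "hoch (- s) (hoch s f) xs = 0"
proof -
  have s2: "s * s = 1" by (simp add: s flip: power_add)
  consider "xs = []" | a where "xs = [a]" | a b ys where "xs = a # b # ys"
    by (metis list.exhaust)
  then show ?thesis
  proof cases
    case 3
    have "bar p (right f) xs = right (bar p f) xs + sM s (right (right f) xs)"
    proof (cases "length ys = n")
      case True
      then show ?thesis using bar_right[of xs f] 3 by (simp add: s)
    next
      case False
      \<comment> \<open>Off length \<open>n + 2\<close> the sign supplied by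
        \<open>bar_right\<close> need not be \<open>s\<close>, but the term it multiplies
        vanishes.\<close>
      then have "f (butlast (butlast xs)) = 0"
        by (intro f) (use 3 in \<open>simp only: length_butlast, simp\<close>)
      then have "right (right f) xs = 0"
        by (simp only: right_def r_simps)
      then show ?thesis using bar_right[of xs f] 3 by simp
    qed
    moreover have "left (hoch s f) xs = left (left f) xs + left (bar p f) xs + sM s (right (left f) xs)"
      using 3 left_right by (simp add: left_def hoch_def l_simps)
    moreover have "right (hoch s f) xs = right (left f) xs + right (bar p f) xs + sM s (right (right f) xs)"
      by (simp add: right_def hoch_def r_simps)
    moreover have "bar p (hoch s f) xs = bar p (left f) xs + sM s (bar p (right f) xs)"
      by (simp add: hoch_def[abs_def] bar_add bar_bar p_assoc bar_additive[of "sM s"] additive_def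
        vs2.scale_right_distrib)
    moreover have "left (left f) xs + left (bar p f) xs + bar p (left f) xs = 0"
      using 3 left_left by simp
    ultimately show ?thesis
      by (simp add: hoch_def[of "- s"] algebra_simps s2)
  qed (use f[of "[]"] n in \<open>auto simp: hoch_def left_def right_def l_simps r_simps\<close>)
qed

end

section \<open>Multilinearity and the signed differential\<close>

lemma (in vector_space_pair) linear_bar_param:
  "(\<And>ys. Vector_Spaces.linear s1 s2 (\<lambda>x. g x ys)) \<Longrightarrow> Vector_Spaces.linear s1 s2 (\<lambda>x. bar p (g x) xs)"
proof (induction xs arbitrary: g rule: induct_list012)
  case (3 a b xs)
  then show ?case
    by (auto intro!: linear_compose_sub linear_compose_neg simp del: diff_conv_add_uminus)
qed (simp_all add: linear_zero)

context assoc_bimodule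
begin

text \<open>The slot \<open>x\<close> is the left factor of the first merge, its right factor, or
  lies beyond it; the induction on \<open>us\<close> separates these cases. In the first,
  \<open>x\<close> also enters the recursive call as a parameter, which
  \<open>linear_bar_param\<close> covers.\<close>

lemma multilinear_bar:
  assumes "multilinear sA sM f"
  shows "multilinear sA sM (bar p f)"
proof -
  have "Vector_Spaces.linear sA sM (\<lambda>x. bar p f (us @ x # vs))" for us vs
    using assms
  proof (induction us arbitrary: f)
    case Nil
    show ?case
    proof (cases vs)
      case (Cons b ys)
      have "Vector_Spaces.linear sA sM (\<lambda>x. f (x # zs))" for zs
        using Nil by (rule multilinear_head)
      then have "Vector_Spaces.linear sA sM (\<lambda>x. f (p x b # ys))"
        and "Vector_Spaces.linear sA sM (\<lambda>x. bar p (\<lambda>ys. f (x # ys)) (b # ys))"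
        by (auto intro: linear_compose_apply[OF p_linear(1)] linear_bar_param)
      then show ?thesis unfolding Cons
        by (simp add: linear_compose_sub linear_compose_neg)
    qed (simp add: linear_zero)
  next
    case (Cons a us)
    have tail: "multilinear sA sM (\<lambda>ys. f (c # ys))" for c
      using Cons.prems by (rule multilinear_tail)
    show ?case
    proof (cases us)
      case Nil
      have "Vector_Spaces.linear sA sM (\<lambda>x. f (p a x # zs))" for zs
        using Cons.prems by (intro linear_compose_apply[OF p_linear(2)] multilinear_head)
      with Cons.IH[OF tail[of a]] Nil show ?thesis
        by (simp add: linear_compose_sub linear_compose_neg)
    next
      case (Cons b ws)
      have "Vector_Spaces.linear sA sM (\<lambda>x. f (p a b # ws @ x # vs))"
        using tail by (simp add: multilinear_def)
      with Cons.IH[OF tail[of a]] Cons show ?thesis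
        by (simp add: linear_compose_sub linear_compose_neg)
    qed
  qed
  then show ?thesis by (simp add: multilinear_def)
qed

lemma multilinear_left:
  assumes "multilinear sA sM f"
  shows "multilinear sA sM (left f)"
proof -
  have "Vector_Spaces.linear sA sM (\<lambda>x. l a (f (us @ x # vs)))" for a us vs
    by (rule linear_compose_apply[OF _ l_linear(2)]) (use assms in \<open>simp add: multilinear_def\<close>)
  then have "Vector_Spaces.linear sA sM (\<lambda>x. left f (us @ x # vs))" for us vs
    by (cases us) (simp_all add: left_def l_linear)
  then show ?thesis by (simp add: multilinear_def)
qed

lemma multilinear_right:
  assumes "multilinear sA sM f"
  shows "multilinear sA sM (right f)"
proof -
  have "Vector_Spaces.linear sA sM (\<lambda>x. r (f (us @ x # vs)) a)" for a us vs
    by (rule linear_compose_apply[OF _ r_linear(1)]) (use assms in \<open>simp add: multilinear_def\<close>)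
  then have "Vector_Spaces.linear sA sM (\<lambda>x. right f (us @ x # vs))" for us vs
    by (cases vs rule: rev_cases) (simp_all add: right_def r_linear butlast_append)
  then show ?thesis by (simp add: multilinear_def)
qed

lemma multilinear_hoch: "multilinear sA sM f \<Longrightarrow> multilinear sA sM (hoch s f)"
  unfolding hoch_def[abs_def]
  by (intro multilinear_add multilinear_scale multilinear_bar multilinear_left multilinear_right)

lemma hoch_cochain:
  assumes f: "f \<in> cochains sA sM n" and n: "n \<ge> 1"
  shows "hoch s f \<in> cochains sA sM (n + 1)"
proof -
  have 0: "f xs = 0" if "length xs \<noteq> n" for xs
    using f that by (simp add: cochains_iff)
  have "hoch s f xs = 0" if "length xs \<noteq> n + 1" for xs
  proof -
    have "bar p f xs = 0"
      by (rule bar_eq_0) (use that 0 in auto)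
    \<comment> \<open>For the empty list both lengths are 0, which differs from \<open>n\<close> as
      \<open>n \<ge> 1\<close>.\<close>
    moreover have "length (tl xs) \<noteq> n" "length (butlast xs) \<noteq> n"
      using that n by auto
    ultimately show ?thesis
      by (simp add: hoch_def left_def right_def 0 l_simps r_simps)
  qed
  with f multilinear_hoch show ?thesis by (auto simp: cochains_iff)
qed

text \<open>Taking out the sign \<open>(-1) ^ (n + 1)\<close> leaves \<open>(-1) ^ i\<close> at the
  inner faces and puts the same sign on the right face, since its square is 1.\<close>

lemma delta_Hoch_eq:
  assumes f: "f \<in> cochains sA sM n" and n: "n \<ge> 1"
  shows "delta_Hoch sM p l r n f = scale_cochain sM ((-1) ^ (n + 1)) (hoch ((-1) ^ (n + 1)) f)"
proof
  fix xs
  show "delta_Hoch sM p l r n f xs = scale_cochain sM ((-1) ^ (n + 1)) (hoch ((-1) ^ (n + 1)) f) xs"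
  proof (cases "length xs = n + 1")
    case True
    have "(\<Sum>i = 1..n. sM ((-1) ^ (i + n + 1)) (f (merge p i xs))) = sM ((-1) ^ (n + 1)) (bar p f xs)"
      using True
      by (simp add: bar_eq_sum[OF vs2.vector_space_axioms] vs2.scale_sum_right power_add mult.commute
        sum_negf)
    moreover have "(-1) ^ (n + 1) * (-1) ^ (n + 1) = (1 :: 'k)"
      by (simp flip: power_add)
    ultimately show ?thesis
      using True
      by (simp add: delta_Hoch_def scale_cochain_def hoch_def left_def right_def
        vs2.scale_right_distrib del: power_Suc)
  next
    case False
    then show ?thesis
      using hoch_cochain[OF f n]
      by (simp add: delta_Hoch_def scale_cochain_def cochains_iff)
  qed
qed

lemma delta_Hoch_cochain:
  assumes "f \<in> cochains sA sM n" "n \<ge> 1"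
  shows "delta_Hoch sM p l r n f \<in> cochains sA sM (n + 1)"
  unfolding delta_Hoch_eq[OF assms] by (intro cochains_scale hoch_cochain assms)

lemma delta_Hoch_add: "delta_Hoch sM p l r n (f + g) = delta_Hoch sM p l r n f + delta_Hoch sM p l r n g"
  by (simp add: delta_Hoch_def fun_eq_iff l_simps r_simps vs2.scale_right_distrib sum.distrib
      sum_negf sum_subtractf)

lemma delta_Hoch_scale:
  "delta_Hoch sM p l r n (scale_cochain sM c f) = scale_cochain sM c (delta_Hoch sM p l r n f)"
  by (simp add: delta_Hoch_def scale_cochain_def fun_eq_iff l_simps r_simps vs2.scale_right_distrib
      vs2.scale_right_diff_distrib vs2.scale_sum_right sum_negf mult.commute)

lemma delta_Hoch_delta_Hoch:
  assumes "f \<in> cochains sA sM n" "n \<ge> 1"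
  shows "delta_Hoch sM p l r (n + 1) (delta_Hoch sM p l r n f) = 0"
proof -
  let ?s = "(-1) ^ (n + 1) :: 'k"
  have s: "(-1) ^ (n + 1 + 1) = - ?s" by simp
  have "hoch (- ?s) (hoch ?s f) = 0"
    using assms by (intro ext) (simp add: hoch_hoch[where n = n] cochains_iff del: power_Suc)
  moreover have "delta_Hoch sM p l r (n + 1) (hoch ?s f) =
      scale_cochain sM (- ?s) (hoch (- ?s) (hoch ?s f))"
    unfolding s[symmetric] using assms by (intro delta_Hoch_eq hoch_cochain) auto
  ultimately show ?thesis
    unfolding delta_Hoch_eq[OF assms] delta_Hoch_scale
    by (simp add: scale_cochain_def fun_eq_iff)
qed

end

section \<open>Derivations\<close>

text \<open>Recursive like \<open>bar\<close>, so that both unfold together at the head of the list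
  and no degree appears.\<close>

fun slot_sum :: "('a \<Rightarrow> 'a) \<Rightarrow> ('a, 'm::ab_group_add) cochain \<Rightarrow> ('a, 'm) cochain" where
  "slot_sum d f [] = 0"
| "slot_sum d f (a # xs) = f (d a # xs) + slot_sum d (\<lambda>ys. f (a # ys)) xs"

lemma slot_sum_eq_sum: "slot_sum d f xs = (\<Sum>i<length xs. f (xs[i := d (xs ! i)]))"
  by (induction xs arbitrary: f) (simp_all add: sum.lessThan_Suc_shift del: sum.lessThan_Suc)

lemma slot_sum_cong:
  "(\<And>ys. length ys = length xs \<Longrightarrow> f ys = g ys) \<Longrightarrow> slot_sum d f xs = slot_sum d g xs"
  by (simp add: slot_sum_eq_sum)

lemma slot_sum_add: "slot_sum d (\<lambda>xs. f xs + g xs) xs = slot_sum d f xs + slot_sum d g xs"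
  by (simp add: slot_sum_eq_sum sum.distrib)

lemma slot_sum_additive:
  assumes "additive T"
  shows "slot_sum d (\<lambda>xs. T (f xs)) xs = T (slot_sum d f xs)"
  by (simp add: slot_sum_eq_sum additive.sum[OF assms])

lemma slot_sum_minus: "slot_sum d (\<lambda>xs. - f xs) xs = - slot_sum d f xs"
  by (simp add: slot_sum_eq_sum sum_negf)

lemma slot_sum_diff: "slot_sum d (\<lambda>xs. f xs - g xs) xs = slot_sum d f xs - slot_sum d g xs"
  by (simp add: slot_sum_eq_sum sum_subtractf)

lemma slot_sum_snoc:
  "slot_sum d f (xs @ [a]) = slot_sum d (\<lambda>ys. f (ys @ [a])) xs + f (xs @ [d a])"
  by (induction xs arbitrary: f) (simp_all add: add.assoc)

locale assoc_bimodule_derivation = assoc_bimodule sA sM p l r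
  for sA :: "'k::field \<Rightarrow> 'a::ab_group_add \<Rightarrow> 'a" and sM :: "'k \<Rightarrow> 'm::ab_group_add \<Rightarrow> 'm"
    and p l r +
  fixes d :: "'a \<Rightarrow> 'a" and dM :: "'m \<Rightarrow> 'm"
  assumes d_lin: "Vector_Spaces.linear sA sA d"
    and dM_lin: "Vector_Spaces.linear sM sM dM"
    and d_p: "d (p a b) = p (d a) b + p a (d b)"
    and dM_left: "dM (l a m) = l (d a) m + l a (dM m)"
    and dM_right: "dM (r m a) = r (dM m) a + r m (d a)"
begin

lemma dM_add: "dM (x + y) = dM x + dM y"
  and dM_scale: "dM (sM c x) = sM c (dM x)"
  using dM_lin by (auto simp: Vector_Spaces.linear_iff)

interpretation dM: additive dM
  by unfold_locales (rule dM_add)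

text \<open>In a merged slot \<open>d\<close> splits by the Leibniz rule into \<open>d\<close> on
  either factor; in all other slots it commutes with merging.\<close>

lemma slot_sum_bar:
  assumes "multilinear sA sM f"
  shows "slot_sum d (bar p f) xs = bar p (slot_sum d f) xs"
  using assms
proof (induction xs arbitrary: f rule: induct_list012)
  case (3 a b xs)
  have "slot_sum d (\<lambda>zs. bar p f (a # zs)) (b # xs) =
      slot_sum d (\<lambda>zs. - f (p a (hd zs) # tl zs) - bar p (\<lambda>ys. f (a # ys)) zs) (b # xs)"
    by (rule slot_sum_cong) (auto simp: length_Suc_conv)
  also have "\<dots> = - f (p a (d b) # xs) - slot_sum d (\<lambda>ys. f (p a b # ys)) xs
      - bar p (slot_sum d (\<lambda>ys. f (a # ys))) (b # xs)"
    using "3.IH"(2)[OF multilinear_tail[OF "3.prems"]]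
    by (simp add: slot_sum_diff slot_sum_minus)
  finally show ?case
    by (simp add: d_p multilinear_head_add[OF "3.prems"] bar_add)
qed auto

lemma slot_sum_left: "slot_sum d (left f) (a # xs) = l (d a) (f xs) + l a (slot_sum d f xs)"
  by (simp add: left_def slot_sum_additive[of "l a"] additive_def l_simps)

lemma slot_sum_right: "slot_sum d (right f) (xs @ [a]) = r (slot_sum d f xs) a + r (f xs) (d a)"
  by (simp add: right_def slot_sum_snoc slot_sum_additive[of "\<lambda>m. r m a"] additive_def r_simps)

text \<open>The left, right and inner faces commute with the operator separately, so
  \<open>s\<close> is arbitrary. The condition on \<open>f []\<close> handles the empty list, where
  \<open>hd\<close> and \<open>last\<close> are unspecified.\<close>

lemma slot_sum_hoch:
  assumes f: "multilinear sA sM f" and f0: "f [] = 0"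
  shows "slot_sum d (hoch s f) xs - dM (hoch s f xs) = hoch s (\<lambda>xs. slot_sum d f xs - dM (f xs)) xs"
proof (cases "xs = []")
  case True
  then show ?thesis
    by (simp add: hoch_def left_def right_def f0 l_simps r_simps dM.zero)
next
  case False
  have "slot_sum d (left f) xs - dM (left f xs) = left (\<lambda>xs. slot_sum d f xs - dM (f xs)) xs"
    using False by (cases xs) (simp_all only: slot_sum_left, simp_all add: left_def dM_left l_simps)
  moreover have "slot_sum d (right f) xs - dM (right f xs) = right (\<lambda>xs. slot_sum d f xs - dM (f xs)) xs"
    using False by (cases xs rule: rev_cases)
      (simp_all only: slot_sum_right, simp_all add: right_def dM_right r_simps)
  moreover have "slot_sum d (bar p f) xs - dM (bar p f xs) = bar p (\<lambda>xs. slot_sum d f xs - dM (f xs)) xs"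
    by (simp add: slot_sum_bar[OF f] bar_diff bar_additive[of dM] dM.additive_axioms)
  ultimately show ?thesis
    by (simp add: hoch_def[abs_def] slot_sum_add slot_sum_additive[of "sM s"] additive_def
        vs2.scale_right_distrib dM_add dM_scale vs2.scale_right_diff_distrib algebra_simps)
qed

lemma Delta_eq:
  assumes "f \<in> cochains sA sM n"
  shows "Delta d dM n f = (\<lambda>xs. slot_sum d f xs - dM (f xs))"
proof
  fix xs
  show "Delta d dM n f xs = slot_sum d f xs - dM (f xs)"
    using assms by (auto simp: Delta_def slot_sum_eq_sum cochains_iff dM.zero)
qed

lemma Delta_add: "Delta d dM n (f + g) = Delta d dM n f + Delta d dM n g"
  by (simp add: Delta_def fun_eq_iff sum.distrib dM_add)

lemma Delta_scale: "Delta d dM n (scale_cochain sM c f) = scale_cochain sM c (Delta d dM n f)"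
  by (simp add: Delta_def scale_cochain_def fun_eq_iff dM_scale vs2.scale_sum_right
      vs2.scale_right_diff_distrib)

lemma multilinear_slot_sum:
  assumes "multilinear sA sM f"
  shows "multilinear sA sM (slot_sum d f)"
proof -
  \<comment> \<open>Covers the summands in which \<open>d\<close> hits an entry behind
    \<open>x\<close>: there \<open>x\<close> occurs only in the function passed to the
    recursion.\<close>
  have param: "Vector_Spaces.linear sA sM (\<lambda>x. slot_sum d (g x) vs)"
    if "\<And>ys. Vector_Spaces.linear sA sM (\<lambda>x. g x ys)" for g vs
    using that by (induction vs arbitrary: g) (simp_all add: linear_zero linear_compose_add)
  have "Vector_Spaces.linear sA sM (\<lambda>x. slot_sum d f (us @ x # vs))" for us vs
    using assms
  proof (induction us arbitrary: f)
    case Nil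
    have head: "Vector_Spaces.linear sA sM (\<lambda>x. f (x # ys))" for ys
      using Nil by (rule multilinear_head)
    show ?case
      using linear_compose_apply[OF d_lin head, of vs] param[of "\<lambda>x ys. f (x # ys)" vs] head
      by (simp add: linear_compose_add)
  next
    case (Cons a us)
    have "Vector_Spaces.linear sA sM (\<lambda>x. f ((d a # us) @ x # vs))"
      using Cons.prems unfolding multilinear_def by blast
    with Cons.IH[OF multilinear_tail[OF Cons.prems]] show ?case
      by (simp add: linear_compose_add)
  qed
  then show ?thesis by (simp add: multilinear_def)
qed

lemma Delta_cochain:
  assumes "f \<in> cochains sA sM n"
  shows "Delta d dM n f \<in> cochains sA sM n"
proof -
  have "multilinear sA sM (\<lambda>xs. slot_sum d f xs - dM (f xs))"
    using assms
    by (intro multilinear_diff multilinear_slot_sum multilinear_compose[OF _ dM_lin])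
      (simp_all add: cochains_iff)
  then have "multilinear sA sM (Delta d dM n f)"
    unfolding Delta_eq[OF assms] .
  then show ?thesis by (simp add: cochains_iff Delta_def)
qed

lemma Delta_delta_Hoch:
  assumes "f \<in> cochains sA sM n" "n \<ge> 1"
  shows "Delta d dM (n + 1) (delta_Hoch sM p l r n f) = delta_Hoch sM p l r n (Delta d dM n f)"
proof -
  have "Delta d dM (n + 1) (hoch s f) = hoch s (Delta d dM n f)" for s
    unfolding Delta_eq[OF hoch_cochain[OF assms]] Delta_eq[OF assms(1)]
    using assms by (intro ext slot_sum_hoch) (simp_all add: cochains_iff)
  then show ?thesis
    unfolding delta_Hoch_eq[OF assms] delta_Hoch_eq[OF Delta_cochain[OF assms(1)] assms(2)]
      Delta_scale by simp
qed

end

section \<open>The comparison map\<close>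

text \<open>\<open>ext_even\<close> and \<open>ext_odd\<close> are the two components of \<open>f \<circ> (R + t)\<^sup>\<otimes>\<^sup>n\<close> with values in
  \<open>M \<oplus> t M\<close>, where \<open>t\<^sup>2 = - \<kappa>\<close>.\<close>

fun ext_even ext_odd :: "('k::field \<Rightarrow> 'm::ab_group_add \<Rightarrow> 'm) \<Rightarrow> 'k \<Rightarrow> ('a \<Rightarrow> 'a) \<Rightarrow>
    ('a, 'm) cochain \<Rightarrow> ('a, 'm) cochain" where
  "ext_even sM \<kappa> R f [] = f []"
| "ext_odd sM \<kappa> R f [] = 0"
| "ext_even sM \<kappa> R f (a # xs) =
     ext_even sM \<kappa> R (\<lambda>ys. f (R a # ys)) xs - sM \<kappa> (ext_odd sM \<kappa> R (\<lambda>ys. f (a # ys)) xs)"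
| "ext_odd sM \<kappa> R f (a # xs) =
     ext_odd sM \<kappa> R (\<lambda>ys. f (R a # ys)) xs + ext_even sM \<kappa> R (\<lambda>ys. f (a # ys)) xs"

text \<open>Weights depending on the size of \<open>I\<close> alone cover both sums in
  \<open>phi\<close>; leaving \<open>w\<close> free lets it shift in the recursion.\<close>

definition apply_off_sum ::
  "('k::field \<Rightarrow> 'm::ab_group_add \<Rightarrow> 'm) \<Rightarrow> (nat \<Rightarrow> 'k) \<Rightarrow> ('a \<Rightarrow> 'a) \<Rightarrow> ('a, 'm) cochain \<Rightarrow> ('a, 'm) cochain"
  where "apply_off_sum sM w R f xs =
    (\<Sum>I\<in>Pow {..<length xs}. sM (w (card I)) (f (apply_off R I xs)))"

lemma apply_off_Cons:
  "apply_off R (Suc ` I) (a # xs) = R a # apply_off R I xs"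
  "apply_off R (insert 0 (Suc ` I)) (a # xs) = a # apply_off R I xs"
  by (auto simp: apply_off_def upt_conv_Cons simp flip: map_Suc_upt simp del: upt_Suc)

text \<open>Split the subsets by whether they contain position 0. Those that do have one element
  more than their remainder, hence the weight at \<open>Suc k\<close>.\<close>

lemma apply_off_sum_Cons:
  "apply_off_sum sM w R f (a # xs) =
    apply_off_sum sM w R (\<lambda>ys. f (R a # ys)) xs +
    apply_off_sum sM (\<lambda>k. w (Suc k)) R (\<lambda>ys. f (a # ys)) xs"
proof -
  let ?P = "Pow {..<length xs}"
  let ?S = "(`) Suc :: nat set \<Rightarrow> nat set"
  have P: "Pow {..<length (a # xs)} = ?S ` ?P \<union> insert 0 ` ?S ` ?P"
    by (simp add: lessThan_Suc_eq_insert_0 Pow_insert image_Pow_surj[OF refl] del: lessThan_Suc)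
  have inj: "inj_on ?S ?P" "inj_on (insert 0) (?S ` ?P)"
    by (auto simp: inj_on_def)
  have card: "card (Suc ` I) = card I" for I
    by (simp add: card_image)
  have card0: "card (insert 0 (Suc ` I)) = Suc (card I)" if "I \<in> ?P" for I
    using that finite_subset[of I] by (simp add: card)
  have "apply_off_sum sM w R f (a # xs) =
      (\<Sum>I\<in>?S ` ?P. sM (w (card I)) (f (apply_off R I (a # xs)))) +
      (\<Sum>I\<in>insert 0 ` ?S ` ?P. sM (w (card I)) (f (apply_off R I (a # xs))))"
    unfolding apply_off_sum_def P by (rule sum.union_disjoint) auto
  then show ?thesis
    by (simp add: sum.reindex inj apply_off_sum_def card card0 apply_off_Cons del: Pow_iff)
qed

lemma apply_off_sum_scale:
  assumes "vector_space sM"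
  shows "apply_off_sum sM (\<lambda>k. c * w k) R f xs = sM c (apply_off_sum sM w R f xs)"
proof -
  interpret M: vector_space sM by fact
  show ?thesis by (simp add: apply_off_sum_def M.scale_sum_right)
qed

text \<open>With \<open>odd_weight\<close>, the components of the powers of t:
  \<open>t ^ k = even_weight \<kappa> k + t * odd_weight \<kappa> k\<close>. Being zero at the wrong
  parity, they permit sums over all subsets.\<close>

definition even_weight :: "'k::field \<Rightarrow> nat \<Rightarrow> 'k" where
  "even_weight \<kappa> k = (if even k then (- \<kappa>) ^ (k div 2) else 0)"

definition odd_weight :: "'k::field \<Rightarrow> nat \<Rightarrow> 'k" where
  "odd_weight \<kappa> k = (if odd k then (- \<kappa>) ^ ((k - 1) div 2) else 0)"

text \<open>Multiplication by t, where t^2 is \<open>- \<kappa>\<close>.\<close>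

lemma weight_Suc:
  "even_weight \<kappa> (Suc k) = - \<kappa> * odd_weight \<kappa> k" "odd_weight \<kappa> (Suc k) = even_weight \<kappa> k"
  by (auto simp: even_weight_def odd_weight_def elim!: oddE)

text \<open>When the factors \<open>R + t\<close> are expanded slot by slot, \<open>I\<close>
  records the slots that contribute t.\<close>

lemma ext_eq_sum:
  assumes "vector_space sM"
  shows "ext_even sM \<kappa> R f xs = apply_off_sum sM (even_weight \<kappa>) R f xs \<and>
    ext_odd sM \<kappa> R f xs = apply_off_sum sM (odd_weight \<kappa>) R f xs"
proof -
  interpret M: vector_space sM by fact
  show ?thesis
  proof (induction xs arbitrary: f)
    case Nil
    then show ?case
      by (simp add: apply_off_sum_def even_weight_def odd_weight_def apply_off_def)
  next
    case (Cons a xs)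
    then show ?case
      by (simp add: apply_off_sum_Cons weight_Suc apply_off_sum_scale[OF assms]
        apply_off_sum_scale[OF assms, of "- \<kappa>", simplified])
  qed
qed

lemma ext_cong:
  "(\<And>ys. length ys = length xs \<Longrightarrow> f ys = g ys) \<Longrightarrow>
    ext_even sM \<kappa> R f xs = ext_even sM \<kappa> R g xs \<and> ext_odd sM \<kappa> R f xs = ext_odd sM \<kappa> R g xs"
proof (induction xs arbitrary: f g)
  case (Cons a xs)
  have "ext_even sM \<kappa> R (\<lambda>ys. f (c # ys)) xs = ext_even sM \<kappa> R (\<lambda>ys. g (c # ys)) xs \<and>
      ext_odd sM \<kappa> R (\<lambda>ys. f (c # ys)) xs = ext_odd sM \<kappa> R (\<lambda>ys. g (c # ys)) xs" for c
    by (rule Cons.IH) (simp add: Cons.prems)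
  then show ?case by simp
qed simp

context vector_space
begin

lemma ext_zero: "ext_even scale \<kappa> R (\<lambda>xs. 0) xs = 0 \<and> ext_odd scale \<kappa> R (\<lambda>xs. 0) xs = 0"
  by (induction xs) auto

lemma ext_add:
  "ext_even scale \<kappa> R (\<lambda>xs. f xs + g xs) xs = ext_even scale \<kappa> R f xs + ext_even scale \<kappa> R g xs \<and>
   ext_odd scale \<kappa> R (\<lambda>xs. f xs + g xs) xs = ext_odd scale \<kappa> R f xs + ext_odd scale \<kappa> R g xs"
  by (induction xs arbitrary: f g) (auto simp: scale_right_distrib)

lemma ext_linear:
  assumes "Vector_Spaces.linear scale scale T"
  shows "ext_even scale \<kappa> R (\<lambda>xs. T (f xs)) xs = T (ext_even scale \<kappa> R f xs) \<and>
    ext_odd scale \<kappa> R (\<lambda>xs. T (f xs)) xs = T (ext_odd scale \<kappa> R f xs)"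
proof -
  interpret T: Vector_Spaces.linear scale scale T by fact
  show ?thesis
    by (induction xs arbitrary: f) (auto simp: T.diff T.add T.scale)
qed

lemma ext_minus:
  "ext_even scale \<kappa> R (\<lambda>xs. - f xs) xs = - ext_even scale \<kappa> R f xs \<and>
   ext_odd scale \<kappa> R (\<lambda>xs. - f xs) xs = - ext_odd scale \<kappa> R f xs"
  by (rule ext_linear) (rule linear_uminus)

lemma ext_diff:
  "ext_even scale \<kappa> R (\<lambda>xs. f xs - g xs) xs = ext_even scale \<kappa> R f xs - ext_even scale \<kappa> R g xs \<and>
   ext_odd scale \<kappa> R (\<lambda>xs. f xs - g xs) xs = ext_odd scale \<kappa> R f xs - ext_odd scale \<kappa> R g xs"
  using ext_add[of \<kappa> R f "\<lambda>xs. - g xs"] by (simp add: ext_minus)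

text \<open>The factors \<open>R + t\<close> act in separate slots, so the last one can be split off
  as well as the first. The right face requires this form.\<close>

lemma ext_snoc:
  "ext_even scale \<kappa> R f (xs @ [a]) =
     ext_even scale \<kappa> R (\<lambda>ys. f (ys @ [R a])) xs - scale \<kappa> (ext_odd scale \<kappa> R (\<lambda>ys. f (ys @ [a])) xs) \<and>
   ext_odd scale \<kappa> R f (xs @ [a]) =
     ext_odd scale \<kappa> R (\<lambda>ys. f (ys @ [R a])) xs + ext_even scale \<kappa> R (\<lambda>ys. f (ys @ [a])) xs"
  by (induction xs arbitrary: f) (auto simp: algebra_simps)

end

lemma (in vector_space_pair) linear_ext_param:
  assumes "\<And>ys. Vector_Spaces.linear s1 s2 (\<lambda>x. g x ys)"
  shows "Vector_Spaces.linear s1 s2 (\<lambda>x. ext_even s2 \<kappa> R (g x) xs) \<and>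
    Vector_Spaces.linear s1 s2 (\<lambda>x. ext_odd s2 \<kappa> R (g x) xs)"
  using assms
proof (induction xs arbitrary: g)
  case (Cons a xs)
  have "Vector_Spaces.linear s1 s2 (\<lambda>x. ext_even s2 \<kappa> R (\<lambda>ys. g x (c # ys)) xs) \<and>
    Vector_Spaces.linear s1 s2 (\<lambda>x. ext_odd s2 \<kappa> R (\<lambda>ys. g x (c # ys)) xs)" for c
    by (rule Cons.IH) (rule Cons.prems)
  then show ?case
    by (simp add: linear_compose_add linear_compose_sub linear_compose_scale_right)
qed (simp add: linear_zero)

lemma (in vector_space_pair) multilinear_ext:
  assumes "multilinear s1 s2 f" and R: "Vector_Spaces.linear s1 s1 R"
  shows "multilinear s1 s2 (ext_even s2 \<kappa> R f)" "multilinear s1 s2 (ext_odd s2 \<kappa> R f)"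
proof -
  have "Vector_Spaces.linear s1 s2 (\<lambda>x. ext_even s2 \<kappa> R f (us @ x # vs)) \<and>
      Vector_Spaces.linear s1 s2 (\<lambda>x. ext_odd s2 \<kappa> R f (us @ x # vs))" for us vs
    using assms(1)
  proof (induction us arbitrary: f)
    case Nil
    have "Vector_Spaces.linear s1 s2 (\<lambda>x. f (x # ys))" for ys
      using Nil by (rule multilinear_head)
    moreover from this have "Vector_Spaces.linear s1 s2 (\<lambda>x. f (R x # ys))" for ys
      by (rule linear_compose_apply[OF R])
    ultimately show ?case
      using linear_ext_param[of "\<lambda>x ys. f (x # ys)"] linear_ext_param[of "\<lambda>x ys. f (R x # ys)"]
      by (simp add: linear_compose_add linear_compose_sub linear_compose_scale_right)
  next
    case (Cons a us)
    from Cons.IH[OF multilinear_tail[OF Cons.prems]] show ?case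
      by (simp add: linear_compose_add linear_compose_sub linear_compose_scale_right)
  qed
  then show "multilinear s1 s2 (ext_even s2 \<kappa> R f)" "multilinear s1 s2 (ext_odd s2 \<kappa> R f)"
    by (simp_all add: multilinear_def)
qed

section \<open>The twisted bimodule and the cochain map\<close>

context modified_RB_AssDer_bimodule
begin

abbreviation \<mu>R :: "'a \<Rightarrow> 'a \<Rightarrow> 'a" where "\<mu>R \<equiv> \<lambda>a b. \<mu> (R a) b + \<mu> a (R b)"

definition lR :: "'a \<Rightarrow> 'm \<Rightarrow> 'm" where "lR a m = l (R a) m - RM (l a m)"

definition rR :: "'m \<Rightarrow> 'a \<Rightarrow> 'm" where "rR m a = r m (R a) - RM (r m a)"

sublocale H: assoc_bimodule_derivation sA sM \<mu> l r d dM
  using d_linear dM_linear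
  by unfold_locales (simp_all add: mu_bilinear l_bilinear r_bilinear mu_assoc l_mu l_r r_mu
      d_derivation dM_l dM_r Vector_Spaces.linear_iff)

lemmas linear_add = module_hom.add[OF module_hom_linearI]
  and linear_diff = module_hom.diff[OF module_hom_linearI]
  and linear_scale = module_hom.scale[OF module_hom_linearI]

lemmas additivity =
  linear_add[OF H.p_linear(1)] linear_add[OF H.p_linear(2)]
  linear_add[OF H.l_linear(1)] linear_add[OF H.l_linear(2)]
  linear_add[OF H.r_linear(1)] linear_add[OF H.r_linear(2)]
  linear_add[OF R_linear] linear_add[OF RM_linear] linear_add[OF d_linear] linear_add[OF dM_linear]
  linear_diff[OF H.p_linear(1)] linear_diff[OF H.p_linear(2)]
  linear_diff[OF H.l_linear(1)] linear_diff[OF H.l_linear(2)]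
  linear_diff[OF H.r_linear(1)] linear_diff[OF H.r_linear(2)]
  linear_diff[OF R_linear] linear_diff[OF RM_linear] linear_diff[OF dM_linear]

lemmas homogeneity =
  linear_scale[OF H.p_linear(1)] linear_scale[OF H.p_linear(2)]
  linear_scale[OF H.l_linear(1)] linear_scale[OF H.l_linear(2)]
  linear_scale[OF H.r_linear(1)] linear_scale[OF H.r_linear(2)]
  linear_scale[OF R_linear] linear_scale[OF RM_linear] linear_scale[OF d_linear] linear_scale[OF dM_linear]

text \<open>The modified identity oriented as a rewrite rule: it removes
  \<open>R (\<mu> (R a) b)\<close>, so that both sides of an equation reach the same form.\<close>

lemma R_mu: "R (\<mu> (R a) b) = \<mu> (R a) (R b) - R (\<mu> a (R b)) - sA \<kappa> (\<mu> a b)"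
  using R_modified[of a b] by (simp add: additivity)

lemma Rd: "R (d a) = d (R a)" and RMdM: "RM (dM m) = dM (RM m)"
  using R_d_commute RM_dM_commute by (simp_all add: fun_eq_iff)

text \<open>This second instance transfers the results on Hochschild differentials and on
  derivations to \<open>delta_mHoch\<close>.\<close>

sublocale HR: assoc_bimodule_derivation sA sM \<mu>R lR rR d dM
proof unfold_locales
  show "bilinear_map sA sA sA \<mu>R" "bilinear_map sA sM sM lR" "bilinear_map sM sA sM rR"
    by (simp_all add: bilinear_map_def Vector_Spaces.linear_iff lR_def rR_def additivity homogeneity
        A.vector_space_axioms M.vector_space_axioms A.scale_right_distrib M.scale_right_diff_distrib
        algebra_simps)
  \<comment> \<open>Both sides carry the same term in \<kappa>, the triple product
    \<open>\<mu> a (\<mu> b c)\<close> with coefficient \<open>- \<kappa>\<close>.\<close>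
  show "\<mu>R (\<mu>R a b) c = \<mu>R a (\<mu>R b c)" for a b c
    by (simp add: additivity homogeneity R_mu mu_assoc algebra_simps)
  \<comment> \<open>\<open>l_modified\<close> enters at the element \<open>l b m\<close>, and its
    \<kappa>-term meets the one from \<open>R_mu\<close>.\<close>
  show "lR (\<mu>R a b) m = lR a (lR b m)" for a b m
    by (simp add: lR_def additivity homogeneity R_mu l_mu l_modified algebra_simps)
  show "rR m (\<mu>R a b) = rR (rR m a) b" for a b m
    by (simp add: rR_def additivity homogeneity R_mu r_mu r_modified algebra_simps)
  show "lR a (rR m b) = rR (lR a m) b" for a b m
    by (simp add: lR_def rR_def additivity homogeneity l_r l_modified r_modified algebra_simps)
  show "d (\<mu>R a b) = \<mu>R (d a) b + \<mu>R a (d b)" for a b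
    by (simp add: additivity Rd d_derivation algebra_simps)
  show "dM (lR a m) = lR (d a) m + lR a (dM m)" for a m
    by (simp add: lR_def additivity Rd dM_l RMdM[symmetric] algebra_simps)
  show "dM (rR m a) = rR (dM m) a + rR m (d a)" for a m
    by (simp add: rR_def additivity Rd dM_r RMdM[symmetric] algebra_simps)
qed (use d_linear dM_linear in \<open>simp_all add: Vector_Spaces.linear_iff\<close>)

lemma delta_mHoch_eq: "delta_mHoch sM \<mu> R l r RM n f = delta_Hoch sM \<mu>R lR rR n f"
  by (simp add: delta_mHoch_def delta_Hoch_def fun_eq_iff lR_def rR_def M.scale_right_diff_distrib)

text \<open>In \<open>A[t]\<close> the product of \<open>R a + t a\<close> and
  \<open>R b + t b\<close> has even part \<open>\<mu> (R a) (R b) - \<kappa> \<mu> a b\<close> and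
  odd part \<open>\<mu>R a b\<close>. This is the even half of the homomorphism property; the odd
  half is the definition of \<open>\<mu>R\<close>.\<close>

lemma R_mu_R: "R (\<mu>R a b) = \<mu> (R a) (R b) - sA \<kappa> (\<mu> a b)"
  by (simp add: R_modified)

abbreviation Ev where "Ev \<equiv> ext_even sM \<kappa> R"
abbreviation Od where "Od \<equiv> ext_odd sM \<kappa> R"

text \<open>Merging before or after pulling back along \<open>R + t\<close> agrees because
  \<open>R + t\<close> is multiplicative.\<close>

lemma ext_bar:
  assumes "multilinear sA sM f"
  shows "Ev (bar \<mu> f) xs = bar \<mu>R (Ev f) xs \<and> Od (bar \<mu> f) xs = bar \<mu>R (Od f) xs"
  using assms
proof (induction xs arbitrary: f rule: induct_list012)
  case (3 a b xs)
  note f = 3(3)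
  \<comment> \<open>The two components of multiplicativity, read off in the first slot of
    \<open>f\<close>.\<close>
  have split: "f (R (\<mu>R a b) # ys) = f (\<mu> (R a) (R b) # ys) - sM \<kappa> (f (\<mu> a b # ys))"
    "f (\<mu>R a b # ys) = f (\<mu> (R a) b # ys) + f (\<mu> a (R b) # ys)" for ys
    unfolding R_mu_R using linear_diff[OF multilinear_head[OF f]]
    by (simp_all add: multilinear_head_add[OF f] multilinear_head_scale[OF f])
  have additive: "additive (sM \<kappa>)"
    by unfold_locales (rule M.scale_right_distrib)
  have IH: "Ev (bar \<mu> (\<lambda>ys. f (c # ys))) (b # xs) = bar \<mu>R (Ev (\<lambda>ys. f (c # ys))) (b # xs)"
    "Od (bar \<mu> (\<lambda>ys. f (c # ys))) (b # xs) = bar \<mu>R (Od (\<lambda>ys. f (c # ys))) (b # xs)" for c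
    using 3(2)[OF multilinear_tail[OF f]] by simp_all
  have scale_lin: "Vector_Spaces.linear sM sM (sM \<kappa>)"
    by (rule M.linear_scale_self)
  have "Ev (\<lambda>ys. f (R (\<mu>R a b) # ys)) xs =
      Ev (\<lambda>ys. f (\<mu> (R a) (R b) # ys)) xs - sM \<kappa> (Ev (\<lambda>ys. f (\<mu> a b # ys)) xs)"
    "Od (\<lambda>ys. f (R (\<mu>R a b) # ys)) xs =
      Od (\<lambda>ys. f (\<mu> (R a) (R b) # ys)) xs - sM \<kappa> (Od (\<lambda>ys. f (\<mu> a b # ys)) xs)"
    "Ev (\<lambda>ys. f (\<mu>R a b # ys)) xs =
      Ev (\<lambda>ys. f (\<mu> (R a) b # ys)) xs + Ev (\<lambda>ys. f (\<mu> a (R b) # ys)) xs"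
    "Od (\<lambda>ys. f (\<mu>R a b # ys)) xs =
      Od (\<lambda>ys. f (\<mu> (R a) b # ys)) xs + Od (\<lambda>ys. f (\<mu> a (R b) # ys)) xs"
    unfolding split by (simp_all add: M.ext_diff M.ext_add M.ext_linear[OF scale_lin])
  then show ?case
    using IH[of a] IH[of "R a"]
    by (simp add: M.ext_diff M.ext_minus bar_diff bar_add bar_additive[OF additive]
        M.scale_right_distrib M.scale_right_diff_distrib algebra_simps)
qed simp_all

text \<open>\<open>phi\<close> freed of the degree: without the cut-off outside length
  \<open>n\<close> it can be handled by recursion on the list.\<close>

definition Phi :: "('a, 'm) cochain \<Rightarrow> ('a, 'm) cochain" where
  "Phi f xs = Ev f xs - RM (Od f xs)"

text \<open>The map \<open>m0 + t m1 \<mapsto> m0 - RM m1\<close> respects the left actions: this is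
  \<open>l_modified\<close> at the odd component \<open>Od f xs\<close>.\<close>

lemma Phi_left: "Phi (H.left f) (a # xs) = HR.left (Phi f) (a # xs)"
  by (simp add: Phi_def H.left_def HR.left_def lR_def M.ext_linear[OF H.l_linear(2)] additivity
      homogeneity l_modified algebra_simps)

lemma Phi_right: "Phi (H.right f) (xs @ [a]) = HR.right (Phi f) (xs @ [a])"
  by (simp add: Phi_def H.right_def HR.right_def rR_def M.ext_snoc M.ext_linear[OF H.r_linear(1)]
      additivity homogeneity r_modified algebra_simps)

lemma Phi_bar: "multilinear sA sM f \<Longrightarrow> Phi (bar \<mu> f) xs = bar \<mu>R (Phi f) xs"
  by (simp add: Phi_def[abs_def] ext_bar bar_diff bar_additive[of RM] additive_def additivity)

lemma Phi_hoch:
  assumes f: "multilinear sA sM f" and f0: "f [] = 0"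
  shows "Phi (H.hoch s f) xs = HR.hoch s (Phi f) xs"
proof (cases "xs = []")
  case True
  then show ?thesis
    using linear_diff[OF RM_linear, of 0 0]
    by (simp add: Phi_def H.hoch_def HR.hoch_def H.left_def HR.left_def H.right_def HR.right_def f0
        H.l_simps H.r_simps HR.l_simps HR.r_simps)
next
  case False
  have "Phi (H.left f) xs = HR.left (Phi f) xs"
    using False Phi_left by (cases xs) blast+
  moreover have "Phi (H.right f) xs = HR.right (Phi f) xs"
    using False Phi_right by (cases xs rule: rev_cases) blast+
  moreover have "Phi (H.hoch s f) xs = Phi (H.left f) xs + Phi (bar \<mu> f) xs + sM s (Phi (H.right f) xs)"
    by (simp add: Phi_def H.hoch_def[abs_def] M.ext_add M.ext_linear[OF M.linear_scale_self]
        additivity homogeneity M.scale_right_diff_distrib algebra_simps)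
  ultimately show ?thesis
    by (simp add: HR.hoch_def Phi_bar[OF f])
qed

text \<open>\<open>d\<close> commutes with \<open>R\<close>, hence with \<open>R + t\<close> in its
  own slot, and it does not touch the other slots.\<close>

lemma ext_slot_sum:
  "Ev (slot_sum d f) xs = slot_sum d (Ev f) xs \<and> Od (slot_sum d f) xs = slot_sum d (Od f) xs"
proof (induction xs arbitrary: f)
  case (Cons a xs)
  have additive: "additive (sM \<kappa>)"
    by unfold_locales (rule M.scale_right_distrib)
  have "Ev (\<lambda>ys. slot_sum d f (c # ys)) xs = Ev (\<lambda>ys. f (d c # ys)) xs + slot_sum d (Ev (\<lambda>ys. f (c # ys))) xs"
    "Od (\<lambda>ys. slot_sum d f (c # ys)) xs = Od (\<lambda>ys. f (d c # ys)) xs + slot_sum d (Od (\<lambda>ys. f (c # ys))) xs" for c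
    by (simp_all add: M.ext_add Cons.IH)
  then show ?case
    by (simp add: Rd slot_sum_diff slot_sum_add slot_sum_additive[OF additive] M.scale_right_distrib
        algebra_simps)
qed simp

lemma Phi_slot_sum:
  "Phi (\<lambda>xs. slot_sum d f xs - dM (f xs)) xs = slot_sum d (Phi f) xs - dM (Phi f xs)"
  by (simp add: Phi_def[abs_def] M.ext_diff ext_slot_sum M.ext_linear[OF dM_linear] additivity
      slot_sum_diff slot_sum_additive[of RM] additive_def RMdM)

section \<open>Identification of \<open>phi\<close> with \<open>Phi\<close> on cochains\<close>

lemma apply_off_empty: "apply_off R {} xs = map R xs"
  by (rule nth_equalityI) (simp_all add: apply_off_def)

lemma phi_eq:
  assumes "f \<in> cochains sA sM n"
  shows "phi sM \<kappa> R RM n f = Phi f"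
proof
  fix xs
  show "phi sM \<kappa> R RM n f xs = Phi f xs"
  proof (cases "length xs = n")
    case True
    let ?P = "Pow {..<n}"
    interpret RM: Vector_Spaces.linear sM sM RM by (rule RM_linear)
    have "(\<Sum>I | I \<subseteq> {..<n} \<and> odd (card I).
        sM ((- \<kappa>) ^ ((card I - 1) div 2)) (RM (f (apply_off R I xs)))) =
        (\<Sum>I\<in>?P. RM (sM (odd_weight \<kappa> (card I)) (f (apply_off R I xs))))"
      by (rule sum.mono_neutral_cong_left) (auto simp: odd_weight_def RM.scale)
    \<comment> \<open>The empty set has even size and weight 1. It accounts for the leading term
      \<open>f (map R xs)\<close> of \<open>phi\<close>, whose even sum begins at size 2.\<close>
    moreover have "(\<Sum>I\<in>?P. sM (even_weight \<kappa> (card I)) (f (apply_off R I xs))) =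
        f (map R xs) + (\<Sum>I\<in>?P - {{}}. sM (even_weight \<kappa> (card I)) (f (apply_off R I xs)))"
      by (subst sum.remove[of _ "{}"]) (auto simp: even_weight_def apply_off_empty)
    moreover have "(\<Sum>I | I \<subseteq> {..<n} \<and> even (card I) \<and> card I \<ge> 2.
        sM ((- \<kappa>) ^ (card I div 2)) (f (apply_off R I xs))) =
        (\<Sum>I\<in>?P - {{}}. sM (even_weight \<kappa> (card I)) (f (apply_off R I xs)))"
    proof (rule sum.mono_neutral_cong_left)
      have "card I \<ge> 2" if "I \<subseteq> {..<n}" "I \<noteq> {}" "even (card I)" for I
      proof -
        have "card I \<noteq> 0"
          using that finite_subset[of I "{..<n}"] by auto
        with that show ?thesis by (cases "card I = 1") auto
      qed
      then show "\<forall>I\<in>?P - {{}} - {I. I \<subseteq> {..<n} \<and> even (card I) \<and> 2 \<le> card I}.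
          sM (even_weight \<kappa> (card I)) (f (apply_off R I xs)) = 0"
        by (auto simp: even_weight_def)
    qed (auto simp: even_weight_def)
    ultimately show ?thesis
      using True
      by (simp add: phi_def Phi_def ext_eq_sum M.vector_space_axioms apply_off_sum_def RM.sum)
  next
    case False
    \<comment> \<open>Both components depend only on the values of \<open>f\<close> at lists as long
      as \<open>xs\<close>, and there \<open>f\<close> vanishes.\<close>
    then have "Ev f xs = 0 \<and> Od f xs = 0"
      using ext_cong[of xs f "\<lambda>xs. 0" sM \<kappa> R] assms by (auto simp: cochains_iff H.cochains_iff M.ext_zero)
    then show ?thesis
      using False linear_diff[OF RM_linear, of 0 0] by (simp add: phi_def Phi_def)
  qed
qed

lemma phi_cochain:
  assumes "f \<in> cochains sA sM n"
  shows "phi sM \<kappa> R RM n f \<in> cochains sA sM n"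
proof -
  have "multilinear sA sM (Phi f)"
    unfolding Phi_def[abs_def] using assms
    by (intro H.multilinear_diff H.multilinear_ext multilinear_compose[OF _ RM_linear] R_linear)
      (simp_all add: H.cochains_iff)
  then show ?thesis
    by (simp add: H.cochains_iff phi_eq[OF assms, symmetric]) (simp add: phi_def)
qed

lemma phi_add:
  assumes "f \<in> cochains sA sM n" "g \<in> cochains sA sM n"
  shows "phi sM \<kappa> R RM n (f + g) = phi sM \<kappa> R RM n f + phi sM \<kappa> R RM n g"
  unfolding phi_eq[OF assms(1)] phi_eq[OF assms(2)] phi_eq[OF H.cochains_add[OF assms]]
  by (simp add: fun_eq_iff Phi_def plus_fun_def M.ext_add additivity)

lemma phi_scale:
  assumes "f \<in> cochains sA sM n"
  shows "phi sM \<kappa> R RM n (scale_cochain sM c f) = scale_cochain sM c (phi sM \<kappa> R RM n f)"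
  unfolding phi_eq[OF assms] phi_eq[OF H.cochains_scale[OF assms]]
  by (simp add: fun_eq_iff Phi_def scale_cochain_def M.ext_linear[OF M.linear_scale_self] homogeneity
      M.scale_right_diff_distrib)

text \<open>\<open>Phi_hoch\<close> holds for every \<open>s\<close>, and both differentials carry
  the same global sign in degree \<open>n\<close>, which passes through \<open>phi\<close> by
  homogeneity.\<close>

lemma phi_delta_Hoch:
  assumes f: "f \<in> cochains sA sM n" and n: "n \<ge> 1"
  shows "phi sM \<kappa> R RM (n + 1) (delta_Hoch sM \<mu> l r n f) =
    delta_mHoch sM \<mu> R l r RM n (phi sM \<kappa> R RM n f)"
proof -
  have "phi sM \<kappa> R RM (n + 1) (H.hoch s f) = HR.hoch s (phi sM \<kappa> R RM n f)" for s
    unfolding phi_eq[OF H.hoch_cochain[OF assms]] phi_eq[OF f]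
    using assms by (intro ext Phi_hoch) (simp_all add: H.cochains_iff)
  then show ?thesis
    unfolding delta_mHoch_eq H.delta_Hoch_eq[OF assms] HR.delta_Hoch_eq[OF phi_cochain[OF f] n]
      phi_scale[OF H.hoch_cochain[OF assms]] by simp
qed

lemma phi_Delta:
  assumes f: "f \<in> cochains sA sM n"
  shows "phi sM \<kappa> R RM n (Delta d dM n f) = Delta d dM n (phi sM \<kappa> R RM n f)"
  unfolding phi_eq[OF H.Delta_cochain[OF f]] H.Delta_eq[OF phi_cochain[OF f]]
  unfolding H.Delta_eq[OF f] phi_eq[OF f] using Phi_slot_sum by blast

section \<open>The total complex\<close>

abbreviation C where "C \<equiv> cochains sA sM"
abbreviation CA where "CA \<equiv> mRBAA_cochains sA sM"
abbreviation dA where "dA \<equiv> mRBAA_diff sM \<kappa> \<mu> R l r RM"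
abbreviation DA where "DA \<equiv> mRBAA_Delta d dM"
abbreviation hochschild where "hochschild \<equiv> delta_Hoch sM \<mu> l r"
abbreviation mhochschild where "mhochschild \<equiv> delta_mHoch sM \<mu> R l r RM"

lemma vector_space_scale_mRBAA:
  "vector_space (scale_mRBAA sM :: 'k \<Rightarrow> ('a, 'm) cochain \<times> ('a, 'm) cochain \<Rightarrow> _)"
  and scale_mRBAA_Pair: "scale_mRBAA sM c (f, g) = (scale_cochain sM c f, scale_cochain sM c g)"
    for f g :: "('a, 'm) cochain"
proof -
  interpret V: vector_space "scale_cochain sM :: 'k \<Rightarrow> ('a, 'm) cochain \<Rightarrow> _"
    by (rule vector_space_scale_cochain) (rule M.vector_space_axioms)
  interpret P: vector_space_prod "scale_cochain sM :: 'k \<Rightarrow> ('a, 'm) cochain \<Rightarrow> _"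
    "scale_cochain sM :: 'k \<Rightarrow> ('a, 'm) cochain \<Rightarrow> _" ..
  show "vector_space (scale_mRBAA sM :: 'k \<Rightarrow> ('a, 'm) cochain \<times> ('a, 'm) cochain \<Rightarrow> _)"
    unfolding scale_mRBAA_def by (rule P.p.vector_space_axioms)
  show "scale_mRBAA sM c (f, g) = (scale_cochain sM c f, scale_cochain sM c g)"
    for f g :: "('a, 'm) cochain"
    by (simp add: scale_mRBAA_def P.scale_prod)
qed

lemma vector_space_scale_mRBAD:
  "vector_space (scale_mRBAD sM :: 'k \<Rightarrow> ('a, 'm) mRBAD_cochain \<Rightarrow> _)"
  and scale_mRBAD_Pair: "scale_mRBAD sM c (F, G) = (scale_mRBAA sM c F, scale_mRBAA sM c G)"
    for F G :: "('a, 'm) cochain \<times> ('a, 'm) cochain"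
proof -
  interpret V: vector_space "scale_mRBAA sM :: 'k \<Rightarrow> ('a, 'm) cochain \<times> ('a, 'm) cochain \<Rightarrow> _"
    by (rule vector_space_scale_mRBAA)
  interpret P: vector_space_prod "scale_mRBAA sM :: 'k \<Rightarrow> ('a, 'm) cochain \<times> ('a, 'm) cochain \<Rightarrow> _"
    "scale_mRBAA sM :: 'k \<Rightarrow> ('a, 'm) cochain \<times> ('a, 'm) cochain \<Rightarrow> _" ..
  show "vector_space (scale_mRBAD sM :: 'k \<Rightarrow> ('a, 'm) mRBAD_cochain \<Rightarrow> _)"
    unfolding scale_mRBAD_def by (rule P.p.vector_space_axioms)
  show "scale_mRBAD sM c (F, G) = (scale_mRBAA sM c F, scale_mRBAA sM c G)"
    for F G :: "('a, 'm) cochain \<times> ('a, 'm) cochain"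
    by (simp add: scale_mRBAD_def P.scale_prod)
qed

text \<open>With negation as a scalar multiple, compatibility with minus follows from
  homogeneity.\<close>

lemma scale_cochain_minus_one: "scale_cochain sM (- 1) f = - f"
  by (simp add: scale_cochain_def fun_eq_iff)

lemma scale_cochain_zero: "scale_cochain sM c 0 = 0"
  by (simp add: scale_cochain_def fun_eq_iff)

lemma scale_cochain_minus: "scale_cochain sM c (- f) = - scale_cochain sM c f"
  by (simp add: scale_cochain_def fun_eq_iff)

lemma scale_cochain_diff: "scale_cochain sM c (f - g) = scale_cochain sM c f - scale_cochain sM c g"
  by (simp add: scale_cochain_def fun_eq_iff M.scale_right_diff_distrib)

lemma mhochschild_minus: "mhochschild n (- f) = - mhochschild n f"
  using HR.delta_Hoch_scale[of n "-1" f] by (simp add: delta_mHoch_eq scale_cochain_minus_one)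

lemma mhochschild_add: "mhochschild n (f + g) = mhochschild n f + mhochschild n g"
  by (simp add: delta_mHoch_eq HR.delta_Hoch_add)

lemma mhochschild_diff: "mhochschild n (f - g) = mhochschild n f - mhochschild n g"
  using mhochschild_add[of n f "- g"] by (simp add: mhochschild_minus)

lemma Delta_minus: "Delta d dM n (- f) = - Delta d dM n f"
  using H.Delta_scale[of n "-1" f] by (simp add: scale_cochain_minus_one)

lemma Delta_diff: "Delta d dM n (f - g) = Delta d dM n f - Delta d dM n g"
  using H.Delta_add[of n f "- g"] by (simp add: Delta_minus)

lemma CA_add: "F \<in> CA n \<Longrightarrow> G \<in> CA n \<Longrightarrow> F + G \<in> CA n"
  by (auto simp: mRBAA_cochains_def H.cochains_add)

lemma CA_scale: "F \<in> CA n \<Longrightarrow> scale_mRBAA sM c F \<in> CA n"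
  by (auto simp: mRBAA_cochains_def scale_mRBAA_Pair H.cochains_scale scale_cochain_zero
      split: if_splits)

lemma CA_0: "0 \<in> CA n"
  by (auto simp: mRBAA_cochains_def zero_prod_def H.cochains_0)

lemma scale_mRBAA_minus_one: "scale_mRBAA sM (- 1) F = - F" for F :: "('a, 'm) cochain \<times> ('a, 'm) cochain"
  by (cases F) (simp add: scale_mRBAA_Pair scale_cochain_minus_one)

lemma CA_minus: "F \<in> CA n \<Longrightarrow> - F \<in> CA n"
  using CA_scale[of F n "-1"] by (simp add: scale_mRBAA_minus_one)

lemma dA_closed:
  assumes "F \<in> CA n" "n \<ge> 1"
  shows "dA n F \<in> CA (n + 1)"
proof -
  have "mhochschild (n - 1) g \<in> C n" if "g \<in> C (n - 1)" "n \<noteq> 1" for g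
    using HR.delta_Hoch_cochain[OF that(1)] that(2) assms(2) by (simp add: delta_mHoch_eq)
  with assms show ?thesis
    by (auto simp: mRBAA_cochains_def mRBAA_diff_def H.delta_Hoch_cochain[simplified] phi_cochain
        H.cochains_minus H.cochains_diff split: if_splits)
qed

lemma dA_add: "F \<in> CA n \<Longrightarrow> G \<in> CA n \<Longrightarrow> dA n (F + G) = dA n F + dA n G"
  by (auto simp: mRBAA_diff_def mRBAA_cochains_def H.delta_Hoch_add mhochschild_add phi_add
      split: if_splits)

lemma dA_scale: "F \<in> CA n \<Longrightarrow> dA n (scale_mRBAA sM c F) = scale_mRBAA sM c (dA n F)"
  by (auto simp: mRBAA_diff_def mRBAA_cochains_def scale_mRBAA_Pair H.delta_Hoch_scale
      delta_mHoch_eq HR.delta_Hoch_scale phi_scale scale_cochain_minus scale_cochain_diff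
      split: if_splits)

text \<open>A mapping cone of \<open>phi\<close>: in the second component \<open>mhochschild\<close>
  squares to zero and the two cross terms cancel by \<open>phi_delta_Hoch\<close>.\<close>

lemma dA_dA:
  assumes "F \<in> CA n" "n \<ge> 1"
  shows "dA (n + 1) (dA n F) = 0"
proof -
  obtain f g where F: "F = (f, g)" and f: "f \<in> C n" and g: "n \<noteq> 1 \<Longrightarrow> g \<in> C (n - 1)"
    using assms by (cases F) (auto simp: mRBAA_cochains_def split: if_splits)
  have "mhochschild n (mhochschild (n - 1) g) = 0" if "n \<noteq> 1"
    using HR.delta_Hoch_delta_Hoch[OF g[OF that]] that assms(2) by (simp add: delta_mHoch_eq)
  then show ?thesis
    using assms(2) H.delta_Hoch_delta_Hoch[OF f assms(2)] phi_delta_Hoch[OF f assms(2)]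
    by (auto simp: F mRBAA_diff_def mhochschild_minus mhochschild_diff zero_prod_def)
qed

lemma DA_closed: "F \<in> CA n \<Longrightarrow> DA n F \<in> CA n"
  by (auto simp: mRBAA_cochains_def mRBAA_Delta_def H.Delta_cochain[simplified] split: if_splits)

lemma DA_add: "DA n (F + G) = DA n F + DA n G"
  by (cases F; cases G) (simp add: mRBAA_Delta_def H.Delta_add)

lemma DA_scale: "DA n (scale_mRBAA sM c F) = scale_mRBAA sM c (DA n F)"
  by (cases F) (simp add: mRBAA_Delta_def scale_mRBAA_Pair H.Delta_scale scale_cochain_zero)

text \<open>\<open>Delta\<close> commutes with each of the three operators from which
  \<open>dA\<close> is built.\<close>

lemma DA_dA:
  assumes "F \<in> CA n" "n \<ge> 1"
  shows "DA (n + 1) (dA n F) = dA n (DA n F)"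
proof -
  obtain f g where F: "F = (f, g)" and f: "f \<in> C n" and g: "n \<noteq> 1 \<Longrightarrow> g \<in> C (n - 1)"
    using assms by (cases F) (auto simp: mRBAA_cochains_def split: if_splits)
  have "Delta d dM n (mhochschild (n - 1) g) = mhochschild (n - 1) (Delta d dM (n - 1) g)" if "n \<noteq> 1"
    using HR.Delta_delta_Hoch[OF g[OF that]] that assms(2) by (simp add: delta_mHoch_eq)
  then show ?thesis
    using assms(2) H.Delta_delta_Hoch[OF f assms(2)] phi_Delta[OF f]
    by (auto simp: F mRBAA_diff_def mRBAA_Delta_def Delta_minus Delta_diff)
qed

theorem cochain_complex_mRBAD:
  "cochain_complex (scale_mRBAD sM) (mRBAD_cochains sA sM) (mRBAD_diff sM \<kappa> \<mu> R d l r RM dM)"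
proof -
  let ?C = "mRBAD_cochains sA sM" and ?D = "mRBAD_diff sM \<kappa> \<mu> R d l r RM dM"
  interpret V: vector_space "scale_mRBAA sM :: 'k \<Rightarrow> ('a, 'm) cochain \<times> ('a, 'm) cochain \<Rightarrow> _"
    by (rule vector_space_scale_mRBAA)
  interpret W: vector_space "scale_mRBAD sM :: 'k \<Rightarrow> ('a, 'm) mRBAD_cochain \<Rightarrow> _"
    by (rule vector_space_scale_mRBAD)
  \<comment> \<open>Only the outer pair of the zero is split, which leaves the inner pairs to
    \<open>CA_0\<close>.\<close>
  have "W.subspace (?C n)" for n
    by (auto simp: W.subspace_def mRBAD_cochains_def scale_mRBAD_Pair CA_add CA_scale CA_0
        zero_prod_def[where ?'a = "('a, 'm) cochain \<times> ('a, 'm) cochain"] split: if_splits)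
  moreover have "?D n X \<in> ?C (n + 1)" if n: "n \<ge> 1" and X: "X \<in> ?C n" for n X
  proof -
    obtain F G where X': "X = (F, G)" and F: "F \<in> CA n" and G: "n \<noteq> 1 \<Longrightarrow> G \<in> CA (n - 1)"
      using X by (cases X) (auto simp: mRBAD_cochains_def split: if_splits)
    show ?thesis
      using n dA_closed[OF F n] dA_closed[OF G] DA_closed[OF F]
      by (auto simp: X' mRBAD_diff_def mRBAD_cochains_def CA_minus CA_add CA_scale)
  qed
  moreover have "?D n (X + Y) = ?D n X + ?D n Y" if X: "X \<in> ?C n" and Y: "Y \<in> ?C n" for n X Y
  proof -
    obtain F G F' G' where XY: "X = (F, G)" "Y = (F', G')"
      by (metis surj_pair)
    show ?thesis
      using X Y unfolding XY
      by (simp add: mRBAD_diff_def mRBAD_cochains_def dA_add DA_add V.scale_right_distrib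
          split: if_splits)
  qed
  moreover have "?D n (scale_mRBAD sM c X) = scale_mRBAD sM c (?D n X)" if "X \<in> ?C n" for n c X
    using that
    by (auto simp: mRBAD_diff_def mRBAD_cochains_def scale_mRBAD_Pair dA_scale DA_scale
        V.scale_right_distrib mult.commute split: if_splits)
  moreover have "?D (n + 1) (?D n X) = 0" if n: "n \<ge> 1" and X: "X \<in> ?C n" for n X
  proof -
    obtain F G where X': "X = (F, G)" and F: "F \<in> CA n" and G: "n \<noteq> 1 \<Longrightarrow> G \<in> CA (n - 1)"
      using X by (cases X) (auto simp: mRBAD_cochains_def split: if_splits)
    have DF: "DA n F \<in> CA n" by (rule DA_closed) (rule F)
    \<comment> \<open>Used in degree 1, where the differential has a minus in place of the scalar
      \<open>(-1) ^ n\<close>.\<close>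
    have neg: "dA n (- DA n F) = - dA n (DA n F)"
      using dA_scale[OF DF, of "- 1"] by (simp only: scale_mRBAA_minus_one)
    show ?thesis
    proof (cases "n = 1")
      case True
      then show ?thesis
        using dA_dA[OF F n] DA_dA[OF F n] neg
        by (simp add: X' mRBAD_diff_def zero_prod_def[where ?'a = "('a, 'm) cochain \<times> ('a, 'm) cochain"])
    next
      case False
      have G': "G \<in> CA (n - 1)" using G False .
      have dG: "dA (n - 1) G \<in> CA n" and ddG: "dA n (dA (n - 1) G) = 0"
        using dA_closed[OF G'] dA_dA[OF G'] n False by simp_all
      \<comment> \<open>In the second component of the square, \<open>DA (n + 1) (dA n F)\<close>
        enters with the opposite sign \<open>(-1) ^ (n + 1)\<close>, so it cancels this term by
        \<open>DA_dA\<close>.\<close>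
      have "dA n (dA (n - 1) G + scale_mRBAA sM ((-1) ^ n) (DA n F)) =
          scale_mRBAA sM ((-1) ^ n) (dA n (DA n F))"
        unfolding dA_add[OF dG CA_scale[OF DF]] ddG dA_scale[OF DF] by simp
      then show ?thesis
        using dA_dA[OF F n] DA_dA[OF F n] n False
        by (simp add: X' mRBAD_diff_def zero_prod_def[where ?'a = "('a, 'm) cochain \<times> ('a, 'm) cochain"])
    qed
  qed
  ultimately show ?thesis
    unfolding cochain_complex_def using W.vector_space_axioms by blast
qed

end

theorem theorem3p3:
  fixes sA :: "'k::field \<Rightarrow> 'a::ab_group_add \<Rightarrow> 'a"
    and sM :: "'k \<Rightarrow> 'm::ab_group_add \<Rightarrow> 'm"
    and \<kappa> :: 'k
    and \<mu> :: "'a \<Rightarrow> 'a \<Rightarrow> 'a" and R d :: "'a \<Rightarrow> 'a"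
    and l :: "'a \<Rightarrow> 'm \<Rightarrow> 'm" and r :: "'m \<Rightarrow> 'a \<Rightarrow> 'm" and RM dM :: "'m \<Rightarrow> 'm"
  assumes "modified_RB_AssDer_pair sA \<kappa> \<mu> R d"
    and "modified_RB_AssDer_bimodule sA \<kappa> \<mu> R d sM l r RM dM"
  shows "cochain_complex (scale_mRBAD sM) (mRBAD_cochains sA sM)
           (mRBAD_diff sM \<kappa> \<mu> R d l r RM dM)"
  using assms(2) by (rule modified_RB_AssDer_bimodule.cochain_complex_mRBAD)

end
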